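(* Let $G$ be a second countable, locally compact, étale groupoid whose topology is induced by a metric $d_G$, and let $\pi$ be a faithful representation of the $*$-algebra $C_c(G)$ on a Hilbert space $H$, with $C^*_\pi(G)$ the completion of $\pi(C_c(G))$ in $\mathcal B(H)$. Suppose that the range and source maps $r,s:G\to G^{(0)}$ are locally bi-Lipschitz with respect to the metric $d_G$. Then the complex vector space of compactly supported Lipschitz functions $\mathrm{Lip}_c(G,d_G)$ forms a dense $*$-subalgebra of $C^*_\pi(G)$.
   Context: The unit space $G^{(0)}$ is regarded as a subset of $G$ and carries the restriction of $d_G$. The range and source maps are $r(\gamma)=\gamma\gamma^{-1}$ and $s(\gamma)=\gamma^{-1}\gamma$; étale means that $r,s$ are local homeomorphisms. $C_c(G)$ is the space of continuous compactly supported complex-valued functions on $G$ with convolution $(f\cdot g)(\gamma)=\sum_{\alpha\beta=\gamma}f(\alpha)g(\beta)$ and involution $f^*(\gamma)=\overline{f(\gamma^{-1})}$; it is regarded as a subalgebra of $C^*_\pi(G)$ via $\pi$. $\mathrm{Lip}_c(G,d_G)$ is the set of compactly supported complex-valued functions on $G$ that are Lipschitz with respect to $d_G$. A map $f:(Y,d_Y)\to(Z,d_Z)$ between metric spaces is locally bi-Lipschitz if for every $a\in Y$ there are $\ell_a>0$ and $\Lambda_a\ge1$ such that $\Lambda_a^{-1}d_Y(a,b)\le d_Z(f(a),f(b))\le\Lambda_a d_Y(a,b)$ for every $b$ in the ball of radius $\ell_a$ about $a$.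
   Formalization: "Locally bi-Lipschitz" is taken with the two-sided estimate for all pairs b, c in the ball about a, not only for pairs (a, b) with the centre; with the centre-only definition the statement is false (Lip_c need not be closed under convolution). *)

theory Defs
  imports "HOL-Analysis.Analysis"
begin

subsection \<open>Etale groupoids\<close>

(* The groupoid is the whole type 'g; multiplication is partial, and gmul is only meaningful
   on the set of composable pairs. *)
record 'g groupoid_data =
  composable :: "('g \<times> 'g) set"
  gmul :: "'g \<Rightarrow> 'g \<Rightarrow> 'g"
  ginv :: "'g \<Rightarrow> 'g"

(* Hahn's axioms.  They imply that (a, b) is composable iff s(a) = r(b). *)
definition is_groupoid :: "'g groupoid_data \<Rightarrow> bool" where
  "is_groupoid G \<longleftrightarrow>
     (\<forall>a b c. (a, b) \<in> composable G \<longrightarrow> (b, c) \<in> composable G \<longrightarrow>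
        (gmul G a b, c) \<in> composable G \<and> (a, gmul G b c) \<in> composable G \<and>
        gmul G (gmul G a b) c = gmul G a (gmul G b c)) \<and>
     (\<forall>a. ginv G (ginv G a) = a) \<and>
     (\<forall>a. (a, ginv G a) \<in> composable G) \<and>
     (\<forall>a b. (a, b) \<in> composable G \<longrightarrow>
        gmul G (ginv G a) (gmul G a b) = b \<and> gmul G (gmul G a b) (ginv G b) = a)"

definition range_map :: "'g groupoid_data \<Rightarrow> 'g \<Rightarrow> 'g" where
  "range_map G a = gmul G a (ginv G a)"

definition source_map :: "'g groupoid_data \<Rightarrow> 'g \<Rightarrow> 'g" where
  "source_map G a = gmul G (ginv G a) a"

definition unit_space :: "'g groupoid_data \<Rightarrow> 'g set" where
  "unit_space G = range (range_map G)"

definition topological_groupoid :: "'g::topological_space groupoid_data \<Rightarrow> bool" where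
  "topological_groupoid G \<longleftrightarrow> is_groupoid G \<and>
     continuous_on (composable G) (\<lambda>(a, b). gmul G a b) \<and> continuous_on UNIV (ginv G)"

definition local_homeomorphism_into ::
    "('a::topological_space \<Rightarrow> 'b::topological_space) \<Rightarrow> 'b set \<Rightarrow> bool" where
  "local_homeomorphism_into f Y \<longleftrightarrow>
     (\<forall>x. \<exists>U g. open U \<and> x \<in> U \<and> openin (top_of_set Y) (f ` U) \<and> homeomorphism U (f ` U) f g)"

definition etale_groupoid :: "'g::topological_space groupoid_data \<Rightarrow> bool" where
  "etale_groupoid G \<longleftrightarrow> topological_groupoid G \<and>
     local_homeomorphism_into (range_map G) (unit_space G) \<and>
     local_homeomorphism_into (source_map G) (unit_space G)"

subsection \<open>Locally bi-Lipschitz maps\<close>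

(* Both points b, c of the estimate vary in the ball about a.  Fixing one of them to be the
   centre a would only give a pointwise condition: with it, inversion and multiplication of an
   etale groupoid need not be locally Lipschitz even if r and s satisfy the condition, and
   compactly supported Lipschitz functions need not be closed under convolution.  For example,
   let X = {0} \<union> {2^-k} \<union> {2^-k + 8^-k} and Y = {0} \<union> {2^-k} \<union> {2^-k + 4^-k} (k \<ge> 1).  The
   evident bijection X \<rightarrow> Y and its inverse satisfy the pointwise condition, but composing with
   it does not preserve Lipschitz functions; give X \<times> Z/2 the metric of X on the unit space
   and that of Y on the other sheet, with unit distance between sheets added. *)
definition locally_bi_lipschitz :: "('a::metric_space \<Rightarrow> 'b::metric_space) \<Rightarrow> bool" where
  "locally_bi_lipschitz f \<longleftrightarrow>
     (\<forall>a. \<exists>l>0. \<exists>L\<ge>1. \<forall>b\<in>ball a l. \<forall>c\<in>ball a l.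
        inverse L * dist b c \<le> dist (f b) (f c) \<and> dist (f b) (f c) \<le> L * dist b c)"

subsection \<open>Function algebras\<close>

definition Cc :: "('g::topological_space \<Rightarrow> complex) set" where
  "Cc = {f. continuous_on UNIV f \<and> compact (closure {x. f x \<noteq> 0})}"

definition Lipc :: "('g::metric_space \<Rightarrow> complex) set" where
  "Lipc = {f. (\<exists>L. L-lipschitz_on UNIV f) \<and> compact (closure {x. f x \<noteq> 0})}"

(* For f, g in Cc and G etale only finitely many terms are nonzero. *)
definition convolution ::
    "'g groupoid_data \<Rightarrow> ('g \<Rightarrow> complex) \<Rightarrow> ('g \<Rightarrow> complex) \<Rightarrow> 'g \<Rightarrow> complex" where
  "convolution G f g c =
     (\<Sum>\<^sub>\<infinity>(a, b)\<in>{(a, b). (a, b) \<in> composable G \<and> gmul G a b = c}. f a * g b)"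

definition involution :: "'g groupoid_data \<Rightarrow> ('g \<Rightarrow> complex) \<Rightarrow> 'g \<Rightarrow> complex" where
  "involution G f a = cnj (f (ginv G a))"

subsection \<open>Operators on a complex Hilbert space\<close>

class complex_hilbert_space = banach +
  fixes scaleC :: "complex \<Rightarrow> 'a \<Rightarrow> 'a"
    and cinner :: "'a \<Rightarrow> 'a \<Rightarrow> complex"
  assumes scaleC_add_right: "scaleC c (x + y) = scaleC c x + scaleC c y"
    and scaleC_add_left: "scaleC (c + d) x = scaleC c x + scaleC d x"
    and scaleC_scaleC: "scaleC c (scaleC d x) = scaleC (c * d) x"
    and scaleC_of_real: "scaleC (complex_of_real t) x = scaleR t x"
    and cinner_add_left: "cinner (x + y) z = cinner x z + cinner y z"
    and cinner_scaleC_left: "cinner (scaleC c x) y = c * cinner x y"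
    and cinner_commute: "cinner x y = cnj (cinner y x)"
    and cinner_self: "cinner x x = complex_of_real ((norm x)\<^sup>2)"

(* The norm of a blinfun is its operator norm; a bounded complex-linear operator has the same
   operator norm whether it is regarded as complex-linear or as real-linear. *)
definition bounded_ops :: "('h::complex_hilbert_space \<Rightarrow>\<^sub>L 'h) set" where
  "bounded_ops = {T. \<forall>c v. blinfun_apply T (scaleC c v) = scaleC c (blinfun_apply T v)}"

definition is_adjoint ::
    "('h::complex_hilbert_space \<Rightarrow>\<^sub>L 'h) \<Rightarrow> ('h \<Rightarrow>\<^sub>L 'h) \<Rightarrow> bool" where
  "is_adjoint S T \<longleftrightarrow>
     (\<forall>v w. cinner (blinfun_apply S v) w = cinner v (blinfun_apply T w))"

definition is_representation ::
    "'g::topological_space groupoid_data \<Rightarrow>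
     (('g \<Rightarrow> complex) \<Rightarrow> ('h::complex_hilbert_space \<Rightarrow>\<^sub>L 'h)) \<Rightarrow> bool" where
  "is_representation G \<pi> \<longleftrightarrow>
     (\<forall>f\<in>Cc. \<pi> f \<in> bounded_ops) \<and>
     (\<forall>f\<in>Cc. \<forall>g\<in>Cc. \<pi> (\<lambda>x. f x + g x) = \<pi> f + \<pi> g) \<and>
     (\<forall>c. \<forall>f\<in>Cc. \<forall>v. blinfun_apply (\<pi> (\<lambda>x. c * f x)) v = scaleC c (blinfun_apply (\<pi> f) v)) \<and>
     (\<forall>f\<in>Cc. \<forall>g\<in>Cc. \<pi> (convolution G f g) = \<pi> f o\<^sub>L \<pi> g) \<and>
     (\<forall>f\<in>Cc. is_adjoint (\<pi> (involution G f)) (\<pi> f))"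

definition faithful_representation ::
    "'g::topological_space groupoid_data \<Rightarrow>
     (('g \<Rightarrow> complex) \<Rightarrow> ('h::complex_hilbert_space \<Rightarrow>\<^sub>L 'h)) \<Rightarrow> bool" where
  "faithful_representation G \<pi> \<longleftrightarrow> is_representation G \<pi> \<and> inj_on \<pi> Cc"

(* The completion of the image of Cc, i.e. its operator-norm closure in the Banach space B(H). *)
definition C_star_algebra ::
    "(('g::topological_space \<Rightarrow> complex) \<Rightarrow> ('h::complex_hilbert_space \<Rightarrow>\<^sub>L 'h)) \<Rightarrow>
     ('h \<Rightarrow>\<^sub>L 'h) set" where
  "C_star_algebra \<pi> = closure (\<pi> ` Cc)"

definition star_subalgebra ::
    "('h::complex_hilbert_space \<Rightarrow>\<^sub>L 'h) set \<Rightarrow> ('h \<Rightarrow>\<^sub>L 'h) set \<Rightarrow> bool" where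
  "star_subalgebra A B \<longleftrightarrow> A \<subseteq> B \<and> A \<subseteq> bounded_ops \<and> 0 \<in> A \<and>
     (\<forall>S\<in>A. \<forall>T\<in>A. S + T \<in> A) \<and>
     (\<forall>c. \<forall>T\<in>A. \<exists>S\<in>A. \<forall>v. blinfun_apply S v = scaleC c (blinfun_apply T v)) \<and>
     (\<forall>S\<in>A. \<forall>T\<in>A. S o\<^sub>L T \<in> A) \<and>
     (\<forall>T\<in>A. \<exists>S\<in>A. is_adjoint S T)"

end

theory Submission
  imports Defs
begin

text \<open>
  Two facts have to be shown: compactly supported Lipschitz functions are closed under convolution
  and involution, and they are dense in operator norm.

  For a compactly supported function, being Lipschitz is a local property
  (\<open>lipschitz_near_imp_lipschitz\<close>).  A continuous map into the groupoid is Lipschitz near a point as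
  soon as its composition with the range or the source map is (\<open>lipschitz_near_lift\<close>).  Since
  inversion exchanges range and source, inversion is locally Lipschitz.  Every function in \<open>Cc\<close> or
  \<open>Lipc\<close> is a finite sum of functions of the same kind supported in bisections
  (\<open>small_support_induct\<close>), and for \<open>f\<close> supported in a bisection the convolution of \<open>f\<close> and \<open>g\<close>
  at \<open>y\<close> is a single product \<open>f (\<alpha> y) * g (\<beta> y)\<close>, where \<open>\<alpha>\<close> and \<open>\<beta>\<close> are continuous, \<open>\<alpha> y\<close> has the
  range of \<open>y\<close> and \<open>\<beta> y\<close> has the source of \<open>y\<close> (\<open>convolution_local_form\<close>).  The lifting principle
  makes \<open>\<alpha>\<close> and \<open>\<beta>\<close> locally Lipschitz, hence the convolution too.

  For density, the point is that \<open>norm (\<pi> h)\<close> is at most the supremum of \<open>cmod (h x)\<close> when \<open>h\<close> is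
  supported in a bisection (\<open>norm_rep_bisection_le\<close>).  This is the usual contractivity of
  representations of commutative C*-algebras, applied to the convolution of \<open>involution G h\<close> and
  \<open>h\<close>, which lives on the unit space; a square root in the function algebra takes the place of
  spectral theory.  A continuous function supported in a bisection is a uniform limit of Lipschitz
  functions with no larger support (\<open>Lipc_approx\<close>), so its image is a limit in operator norm, and
  finite sums extend this to all of \<open>Cc\<close>.
\<close>

section \<open>Functions that are Lipschitz near a point\<close>

definition lipschitz_near :: "('a::metric_space \<Rightarrow> 'b::metric_space) \<Rightarrow> 'a \<Rightarrow> bool" where
  "lipschitz_near f x \<longleftrightarrow> (\<exists>L U. open U \<and> x \<in> U \<and> L-lipschitz_on U f)"

lemma lipschitz_nearI: "L-lipschitz_on UNIV f \<Longrightarrow> lipschitz_near f x"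
  unfolding lipschitz_near_def by (intro exI[of _ L] exI[of _ UNIV]) auto

lemma lipschitz_near_isCont: "lipschitz_near f x \<Longrightarrow> isCont f x"
  unfolding lipschitz_near_def
  using continuous_on_eq_continuous_at lipschitz_on_continuous_on by blast

lemma lipschitz_near_cong:
  assumes "lipschitz_near f x" "open V" "x \<in> V" "\<And>y. y \<in> V \<Longrightarrow> g y = f y"
  shows "lipschitz_near g x"
proof -
  obtain L U where U: "open U" "x \<in> U" "L-lipschitz_on U f"
    using assms(1) unfolding lipschitz_near_def by blast
  have "L-lipschitz_on (U \<inter> V) f"
    by (rule lipschitz_on_subset[OF U(3)]) auto
  then have "L-lipschitz_on (U \<inter> V) g"
    by (rule lipschitz_on_transform) (use assms(4) in auto)
  then show ?thesis
    unfolding lipschitz_near_def using U assms(2,3) by (metis IntI open_Int)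
qed

lemma isCont_open_vimage:
  assumes "isCont f x" "open V" "f x \<in> V"
  obtains U where "open U" "x \<in> U" "\<And>y. y \<in> U \<Longrightarrow> f y \<in> V"
  using assms unfolding continuous_at_open by meson

lemma lipschitz_near_compose:
  assumes "lipschitz_near g x" "lipschitz_near f (g x)"
  shows "lipschitz_near (\<lambda>y. f (g y)) x"
proof -
  obtain L U where U: "open U" "x \<in> U" "L-lipschitz_on U g"
    using assms(1) unfolding lipschitz_near_def by blast
  obtain M V where V: "open V" "g x \<in> V" "M-lipschitz_on V f"
    using assms(2) unfolding lipschitz_near_def by blast
  obtain W where W: "open W" "x \<in> W" "\<And>y. y \<in> W \<Longrightarrow> g y \<in> V"
    using isCont_open_vimage[OF lipschitz_near_isCont[OF assms(1)] V(1,2)] by blast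
  have "(M * L)-lipschitz_on (U \<inter> W) (\<lambda>y. f (g y))"
  proof (rule lipschitz_on_compose2[of L "U \<inter> W" g M f])
    show "L-lipschitz_on (U \<inter> W) g"
      by (rule lipschitz_on_subset[OF U(3)]) blast
    have "g ` (U \<inter> W) \<subseteq> V" using W(3) by blast
    then show "M-lipschitz_on (g ` (U \<inter> W)) f"
      by (rule lipschitz_on_subset[OF V(3)])
  qed
  then show ?thesis
    unfolding lipschitz_near_def using U W by (metis IntI open_Int)
qed

lemma lipschitz_near_mult:
  fixes f g :: "'a::metric_space \<Rightarrow> 'b::real_normed_algebra"
  assumes "lipschitz_near f x" "lipschitz_near g x"
  shows "lipschitz_near (\<lambda>y. f y * g y) x"
proof -
  obtain L U where U: "open U" "x \<in> U" "L-lipschitz_on U f"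
    using assms(1) unfolding lipschitz_near_def by blast
  obtain M V where V: "open V" "x \<in> V" "M-lipschitz_on V g"
    using assms(2) unfolding lipschitz_near_def by blast
  obtain U' where U': "open U'" "x \<in> U'" "\<And>y. y \<in> U' \<Longrightarrow> f y \<in> ball 0 (norm (f x) + 1)"
    using isCont_open_vimage[OF lipschitz_near_isCont[OF assms(1)], of "ball 0 (norm (f x) + 1)"]
    by auto
  obtain V' where V': "open V'" "x \<in> V'" "\<And>y. y \<in> V' \<Longrightarrow> g y \<in> ball 0 (norm (g x) + 1)"
    using isCont_open_vimage[OF lipschitz_near_isCont[OF assms(2)], of "ball 0 (norm (g x) + 1)"]
    by auto
  define W where "W = U \<inter> V \<inter> U' \<inter> V'"
  define A where "A = norm (f x) + 1"
  define B where "B = norm (g x) + 1"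
  have L: "0 \<le> L" "0 \<le> M" using U(3) V(3) by (auto intro: lipschitz_on_nonneg)
  have AB: "0 \<le> A" "0 \<le> B" by (auto simp: A_def B_def)
  have "(A * M + L * B)-lipschitz_on W (\<lambda>y. f y * g y)"
  proof (rule lipschitz_onI)
    fix y z assume y: "y \<in> W" and z: "z \<in> W"
    have f: "norm (f y - f z) \<le> L * dist y z"
      using lipschitz_onD[OF U(3)] y z by (auto simp: W_def dist_norm)
    have g: "norm (g y - g z) \<le> M * dist y z"
      using lipschitz_onD[OF V(3)] y z by (auto simp: W_def dist_norm)
    have fA: "norm (f y) \<le> A" using U'(3)[of y] y by (auto simp: W_def A_def)
    have gB: "norm (g z) \<le> B" using V'(3)[of z] z by (auto simp: W_def B_def)
    have "dist (f y * g y) (f z * g z) = norm (f y * (g y - g z) + (f y - f z) * g z)"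
      by (simp add: dist_norm algebra_simps)
    also have "\<dots> \<le> norm (f y) * norm (g y - g z) + norm (f y - f z) * norm (g z)"
      by (meson add_mono norm_mult_ineq norm_triangle_le)
    also have "\<dots> \<le> A * (M * dist y z) + (L * dist y z) * B"
      using f g fA gB AB L by (intro add_mono mult_mono) auto
    finally show "dist (f y * g y) (f z * g z) \<le> (A * M + L * B) * dist y z"
      by (simp add: algebra_simps)
  qed (use AB L in auto)
  moreover have "open W" "x \<in> W" using U V U' V' by (auto simp: W_def)
  ultimately show ?thesis unfolding lipschitz_near_def by blast
qed

text \<open>
  A continuous lift through a locally bi-Lipschitz map is Lipschitz wherever the lifted map is:
  continuity brings nearby values of the lift into a ball on which the lower bi-Lipschitz bound
  applies.  In an etale groupoid this carries the hypothesis on range and source over to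
  inversion, to local sections and to multiplication.
\<close>

lemma lipschitz_near_lift:
  assumes p: "locally_bi_lipschitz p" and q: "isCont q x"
    and pq: "lipschitz_near (\<lambda>y. p (q y)) x"
  shows "lipschitz_near q x"
proof -
  obtain l L where l: "l > 0" "L \<ge> 1"
    and bi: "\<And>b c. b \<in> ball (q x) l \<Longrightarrow> c \<in> ball (q x) l \<Longrightarrow> inverse L * dist b c \<le> dist (p b) (p c)"
    using p unfolding locally_bi_lipschitz_def by meson
  obtain M U where U: "open U" "x \<in> U" "M-lipschitz_on U (\<lambda>y. p (q y))"
    using pq unfolding lipschitz_near_def by blast
  obtain V where V: "open V" "x \<in> V" "\<And>y. y \<in> V \<Longrightarrow> q y \<in> ball (q x) l"
    using isCont_open_vimage[OF q, of "ball (q x) l"] l(1) by auto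
  have "(L * M)-lipschitz_on (U \<inter> V) q"
  proof (rule lipschitz_onI)
    fix y z assume yz: "y \<in> U \<inter> V" "z \<in> U \<inter> V"
    have "inverse L * dist (q y) (q z) \<le> dist (p (q y)) (p (q z))"
      using bi V(3) yz by auto
    also have "\<dots> \<le> M * dist y z" using lipschitz_onD[OF U(3)] yz by auto
    finally show "dist (q y) (q z) \<le> L * M * dist y z"
      using l(2) by (simp add: field_simps)
  qed (use l lipschitz_on_nonneg[OF U(3)] in auto)
  then show ?thesis unfolding lipschitz_near_def using U V by (metis IntI open_Int)
qed

lemma locally_bi_lipschitz_near: "locally_bi_lipschitz f \<Longrightarrow> lipschitz_near f x"
  unfolding locally_bi_lipschitz_def lipschitz_near_def lipschitz_on_def
  by (metis centre_in_ball open_ball order.trans zero_le_one)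

text \<open>
  Near the support the Lipschitz constants are uniform by compactness; at distances above the
  Lebesgue number of a finite cover, boundedness of the function suffices.
\<close>

lemma lipschitz_near_imp_lipschitz:
  fixes f :: "'a::metric_space \<Rightarrow> 'b::real_normed_vector"
  assumes near: "\<And>x. lipschitz_near f x" and K: "compact K" and supp: "{x. f x \<noteq> 0} \<subseteq> K"
  shows "\<exists>L. L-lipschitz_on UNIV f"
proof -
  obtain L U where U: "\<And>x. open (U x)" "\<And>x. x \<in> U x" "\<And>x. (L x)-lipschitz_on (U x) f"
    using near unfolding lipschitz_near_def by metis
  obtain T where T: "T \<subseteq> K" "finite T" "K \<subseteq> (\<Union>x\<in>T. U x)"
    using compactE_image[OF K, of K U] U(1,2) by (metis UN_I subsetI)
  have openU: "\<And>G. G \<in> U ` T \<Longrightarrow> open G" using U(1) by auto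
  obtain d where d: "d > 0" "\<And>x. x \<in> K \<Longrightarrow> \<exists>G\<in>U ` T. ball x d \<subseteq> G"
    using Heine_Borel_lemma[OF K T(3) openU] by blast
  have "continuous_on K f"
    using near lipschitz_near_isCont by (auto intro!: continuous_at_imp_continuous_on)
  then have "bounded (f ` K)" using K compact_continuous_image compact_imp_bounded by blast
  then obtain B where B: "\<And>x. x \<in> K \<Longrightarrow> norm (f x) \<le> B" "B > 0"
    by (auto simp: bounded_pos)
  have fB: "norm (f x) \<le> B" for x using B(1)[of x] B(2) supp by (cases "f x = 0") auto
  define M where "M = (\<Sum>x\<in>T. L x)"
  have L0: "0 \<le> L x" for x using U(3) lipschitz_on_nonneg by blast
  have M0: "0 \<le> M" by (auto simp: M_def L0 intro: sum_nonneg)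
  have LM: "L x \<le> M" if "x \<in> T" for x
    unfolding M_def using T(2) that L0 by (simp add: member_le_sum)
  have step: "dist (f x) (f y) \<le> M * dist x y" if "x \<in> K" "dist x y < d" for x y
  proof -
    obtain t where t: "t \<in> T" "ball x d \<subseteq> U t" using d(2)[OF \<open>x \<in> K\<close>] by blast
    have "dist (f x) (f y) \<le> L t * dist x y"
      using lipschitz_onD[OF U(3)] t(2) that(2) d(1) by (auto simp: subset_iff)
    also have "\<dots> \<le> M * dist x y" using LM[OF t(1)] by (simp add: mult_right_mono)
    finally show ?thesis .
  qed
  have "(M + 2 * B / d)-lipschitz_on UNIV f"
  proof (rule lipschitz_onI)
    fix x y
    have "dist (f x) (f y) \<le> M * dist x y \<or> dist (f x) (f y) \<le> 2 * B / d * dist x y"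
    proof (cases "dist x y < d")
      case True
      show ?thesis
      proof (cases "x \<in> K \<or> y \<in> K")
        case True
        then show ?thesis using step \<open>dist x y < d\<close> by (metis dist_commute)
      next
        case False
        then have "f x = 0" "f y = 0" using supp by auto
        then show ?thesis using M0 by simp
      qed
    next
      case False
      have "dist (f x) (f y) \<le> 2 * B"
        using fB[of x] fB[of y] norm_triangle_ineq4[of "f x" "f y"] by (simp add: dist_norm)
      also have "\<dots> \<le> 2 * B / d * dist x y"
        using False d(1) B(2) by (simp add: field_simps)
      finally show ?thesis by simp
    qed
    moreover have "0 \<le> M * dist x y" "0 \<le> 2 * B / d * dist x y" using M0 B(2) d(1) by auto
    ultimately show "dist (f x) (f y) \<le> (M + 2 * B / d) * dist x y"
      by (auto simp: distrib_right)
  qed (use M0 B(2) d(1) in auto)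
  then show ?thesis by blast
qed

section \<open>Compactly supported continuous and Lipschitz functions\<close>

lemma compact_closure_iff:
  fixes S :: "'a::t2_space set"
  shows "compact (closure S) \<longleftrightarrow> (\<exists>K. compact K \<and> S \<subseteq> K)"
  by (metis closure_minimal closure_subset compact_Int_closed compact_imp_closed closed_closure inf.absorb_iff2)

lemma Cc_iff:
  fixes f :: "'a::t2_space \<Rightarrow> complex"
  shows "f \<in> Cc \<longleftrightarrow> (\<forall>x. isCont f x) \<and> (\<exists>K. compact K \<and> {x. f x \<noteq> 0} \<subseteq> K)"
  unfolding Cc_def compact_closure_iff by (simp add: continuous_on_eq_continuous_at)

lemma Lipc_iff:
  "f \<in> Lipc \<longleftrightarrow> (\<forall>x. lipschitz_near f x) \<and> (\<exists>K. compact K \<and> {x. f x \<noteq> 0} \<subseteq> K)"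
  unfolding Lipc_def compact_closure_iff
  using lipschitz_near_imp_lipschitz[of f] by (auto intro: lipschitz_nearI)

lemma Lipc_subset_Cc: "Lipc \<subseteq> Cc"
  by (auto simp: Lipc_iff Cc_iff lipschitz_near_isCont)

lemma compact_support_cover:
  assumes "\<exists>K. compact K \<and> {x. f x \<noteq> 0} \<subseteq> K" "\<exists>K. compact K \<and> {x. g x \<noteq> 0} \<subseteq> K"
    and "\<And>x. h x \<noteq> 0 \<Longrightarrow> f x \<noteq> 0 \<or> g x \<noteq> 0"
  shows "\<exists>K. compact K \<and> {x. h x \<noteq> 0} \<subseteq> K"
proof -
  obtain K L where "compact K" "{x. f x \<noteq> 0} \<subseteq> K" "compact L" "{x. g x \<noteq> 0} \<subseteq> L"
    using assms by blast
  then show ?thesis using assms(3) by (intro exI[of _ "K \<union> L"]) auto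
qed

lemma zero_Lipc: "(\<lambda>x. 0) \<in> Lipc"
  by (auto simp: Lipc_iff intro!: lipschitz_nearI[OF lipschitz_on_constant] exI[of _ "{}"])

lemma Cc_add:
  fixes f g :: "'a::t2_space \<Rightarrow> complex"
  assumes "f \<in> Cc" "g \<in> Cc" shows "(\<lambda>x. f x + g x) \<in> Cc"
proof -
  have "\<exists>K. compact K \<and> {x. f x + g x \<noteq> 0} \<subseteq> K"
    by (rule compact_support_cover[of f g]) (use assms in \<open>auto simp: Cc_iff\<close>)
  then show ?thesis using assms by (simp add: Cc_iff)
qed

lemma Lipc_add:
  assumes "f \<in> Lipc" "g \<in> Lipc" shows "(\<lambda>x. f x + g x) \<in> Lipc"
proof -
  have "\<exists>K. compact K \<and> {x. f x + g x \<noteq> 0} \<subseteq> K"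
    by (rule compact_support_cover[of f g]) (use assms in \<open>auto simp: Lipc_iff\<close>)
  moreover have "\<exists>L. L-lipschitz_on UNIV (\<lambda>x. f x + g x)"
    using assms lipschitz_on_add unfolding Lipc_def by fast
  ultimately show ?thesis by (auto simp: Lipc_def compact_closure_iff)
qed

lemma Cc_mult_left:
  fixes f :: "'a::t2_space \<Rightarrow> complex"
  assumes "f \<in> Cc" "\<And>x. isCont p x" shows "(\<lambda>x. p x * f x) \<in> Cc"
  using assms by (fastforce simp: Cc_iff)

lemma Lipc_mult_left:
  assumes "f \<in> Lipc" "\<And>x. lipschitz_near p x" shows "(\<lambda>x. p x * f x) \<in> Lipc"
  using assms unfolding Lipc_iff by (fastforce intro: lipschitz_near_mult)

lemma Cc_cmult:
  fixes f :: "'a::t2_space \<Rightarrow> complex"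
  shows "f \<in> Cc \<Longrightarrow> (\<lambda>x. c * f x) \<in> Cc"
  by (intro Cc_mult_left) auto

lemma Lipc_cmult: "f \<in> Lipc \<Longrightarrow> (\<lambda>x. c * f x) \<in> Lipc"
  by (intro Lipc_mult_left) (auto intro!: lipschitz_nearI[OF lipschitz_on_constant])

text \<open>
  The approximant is the largest \<open>n\<close>-Lipschitz function below \<open>h\<close>, an infimal convolution.  It
  stays between \<open>0\<close> and \<open>h\<close>, so it vanishes wherever \<open>h\<close> does.
\<close>

lemma lipschitz_minorant:
  fixes h :: "'a::metric_space \<Rightarrow> real"
  assumes cont: "\<And>x. isCont h x" and K: "compact K" and supp: "{x. h x \<noteq> 0} \<subseteq> K"
    and nonneg: "\<And>x. 0 \<le> h x" and e: "e > 0"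
  shows "\<exists>v L. L-lipschitz_on UNIV v \<and> (\<forall>x. 0 \<le> v x \<and> v x \<le> h x \<and> h x \<le> v x + e)"
proof -
  \<comment> \<open>A Lebesgue number of this cover makes \<open>h\<close> uniformly continuous at the points of \<open>K\<close>,
     also with respect to points outside \<open>K\<close>.\<close>
  define W where "W x = {z. \<bar>h z - h x\<bar> < e / 2}" for x
  have W: "open (W x)" for x
    unfolding W_def using cont
    by (intro open_Collect_less continuous_intros) (auto intro: continuous_at_imp_continuous_on)
  have "x \<in> W x" for x using e by (simp add: W_def)
  then have KW: "K \<subseteq> \<Union> (range W)" by blast
  obtain d where d: "d > 0" "\<And>x. x \<in> K \<Longrightarrow> \<exists>G\<in>range W. ball x d \<subseteq> G"
    using Heine_Borel_lemma[OF K KW] W by blast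
  have close: "h x \<le> h y + e" if "x \<in> K" "dist x y < d" for x y
  proof -
    obtain z where z: "ball x d \<subseteq> W z" using d(2)[OF \<open>x \<in> K\<close>] by blast
    then have "x \<in> W z" "y \<in> W z" using that d(1) by auto
    then show ?thesis unfolding W_def mem_Collect_eq by linarith
  qed
  have "continuous_on K h" using cont by (auto intro!: continuous_at_imp_continuous_on)
  then have "bounded (h ` K)" using K compact_continuous_image compact_imp_bounded by blast
  then obtain B where B: "\<And>x. x \<in> K \<Longrightarrow> norm (h x) \<le> B" "B > 0"
    by (auto simp: bounded_pos)
  \<comment> \<open>With this slope a step of length at least \<open>d\<close> already costs the maximum \<open>B\<close> of \<open>h\<close>.\<close>
  define n where "n = B / d"
  have n: "n \<ge> 0" using B d by (auto simp: n_def)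
  have key: "h x \<le> h y + n * dist x y + e" for x y
  proof (cases "x \<in> K")
    case True
    show ?thesis
    proof (cases "dist x y < d")
      case True
      then show ?thesis using close[OF \<open>x \<in> K\<close>] n by (smt (verit) mult_nonneg_nonneg zero_le_dist)
    next
      case False
      then have "B \<le> n * dist x y" using d(1) B(2) by (simp add: n_def field_simps)
      then show ?thesis using B(1)[OF \<open>x \<in> K\<close>] nonneg[of y] e by auto
    qed
  next
    case False
    then have "h x = 0" using supp by auto
    then show ?thesis using nonneg[of y] n e by (smt (verit) mult_nonneg_nonneg zero_le_dist)
  qed
  define v where "v x = (INF y. h y + n * dist x y)" for x
  have bdd: "bdd_below (range (\<lambda>y. h y + n * dist x y))" for x
    by (rule bdd_belowI[of _ 0]) (use nonneg n in auto)
  have lower: "v x \<le> h y + n * dist x y" for x y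
    unfolding v_def by (rule cINF_lower[OF bdd]) simp
  have greatest: "c \<le> v x" if "\<And>y. c \<le> h y + n * dist x y" for c x
    unfolding v_def by (rule cINF_greatest) (use that in auto)
  have vn: "v x \<le> v z + n * dist x z" for x z
  proof -
    have "v x - n * dist x z \<le> v z"
    proof (rule greatest)
      fix y
      have "n * dist x y \<le> n * dist x z + n * dist z y"
        using n dist_triangle[of x y z] by (metis distrib_left mult_left_mono)
      then show "v x - n * dist x z \<le> h y + n * dist z y" using lower[of x y] by linarith
    qed
    then show ?thesis by simp
  qed
  have "n-lipschitz_on UNIV v"
  proof (rule lipschitz_onI)
    fix x y
    show "dist (v x) (v y) \<le> n * dist x y"
      using vn[of x y] vn[of y x] by (auto simp: dist_real_def dist_commute)
  qed (rule n)
  moreover have "0 \<le> v x \<and> v x \<le> h x \<and> h x \<le> v x + e" for x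
  proof -
    have "h x - e \<le> v x" by (rule greatest) (use key[of x] in \<open>simp add: algebra_simps\<close>)
    moreover have "0 \<le> v x" by (rule greatest) (use nonneg n in auto)
    ultimately show ?thesis using lower[of x x] by auto
  qed
  ultimately show ?thesis by blast
qed

lemma Lipc_approx_nonneg:
  fixes h :: "'a::metric_space \<Rightarrow> real"
  assumes "\<And>x. isCont h x" "compact K" "{x. h x \<noteq> 0} \<subseteq> K" "\<And>x. 0 \<le> h x" "e > 0"
  shows "\<exists>v\<in>Lipc. \<forall>x. cmod (complex_of_real (h x) - v x) \<le> e \<and> (h x = 0 \<longrightarrow> v x = 0)"
proof -
  obtain v L where v: "L-lipschitz_on UNIV v" "\<And>x. 0 \<le> v x" "\<And>x. v x \<le> h x" "\<And>x. h x \<le> v x + e"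
    using lipschitz_minorant[OF assms] by blast
  have v0: "h x = 0 \<Longrightarrow> v x = 0" for x using v(2,3)[of x] by auto
  have "L-lipschitz_on UNIV (\<lambda>x. complex_of_real (v x))"
    using v(1) unfolding lipschitz_on_def dist_of_real .
  moreover have "{x. complex_of_real (v x) \<noteq> 0} \<subseteq> K" using v0 assms(3) by auto
  ultimately have "(\<lambda>x. complex_of_real (v x)) \<in> Lipc"
    using assms(2) by (auto simp: Lipc_def compact_closure_iff)
  moreover have "cmod (complex_of_real (h x) - complex_of_real (v x)) \<le> e" for x
    using v(3,4)[of x] by (simp flip: of_real_diff)
  ultimately show ?thesis using v0 by (intro bexI[of _ "\<lambda>x. complex_of_real (v x)"]) auto
qed

text \<open>
  The positive and negative parts of the real and imaginary parts vanish where \<open>h\<close> does, so the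
  approximant inherits the support of \<open>h\<close>.  Small sets of support are thereby preserved, as the
  norm estimate for bisections requires.
\<close>

lemma Lipc_approx:
  fixes h :: "'a::metric_space \<Rightarrow> complex"
  assumes h: "h \<in> Cc" and e: "e > 0"
  shows "\<exists>v\<in>Lipc. \<forall>x. cmod (h x - v x) \<le> e \<and> (h x = 0 \<longrightarrow> v x = 0)"
proof -
  obtain K where K: "compact K" "{x. h x \<noteq> 0} \<subseteq> K" and cont: "\<And>x. isCont h x"
    using h by (auto simp: Cc_iff)
  have part: "\<exists>v\<in>Lipc. \<forall>x. cmod (complex_of_real (max 0 (p (h x))) - v x) \<le> e / 4 \<and> (h x = 0 \<longrightarrow> v x = 0)"
    if p: "\<And>z. isCont p z" "p 0 = 0" for p :: "complex \<Rightarrow> real"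
  proof -
    have "\<exists>v\<in>Lipc. \<forall>x. cmod (complex_of_real (max 0 (p (h x))) - v x) \<le> e / 4
        \<and> (max 0 (p (h x)) = 0 \<longrightarrow> v x = 0)"
    proof (rule Lipc_approx_nonneg)
      show "isCont (\<lambda>x. max 0 (p (h x))) x" for x
        using isCont_o2[OF cont p(1)] by (intro continuous_intros)
      show "{x. max 0 (p (h x)) \<noteq> 0} \<subseteq> K" using K(2) p(2) by (auto simp: max_def split: if_splits)
    qed (use K e in auto)
    then show ?thesis using p(2) by fastforce
  qed
  obtain a where a: "a \<in> Lipc" "\<And>x. cmod (complex_of_real (max 0 (Re (h x))) - a x) \<le> e / 4"
      "\<And>x. h x = 0 \<Longrightarrow> a x = 0"
    using part[of Re] by auto
  obtain b where b: "b \<in> Lipc" "\<And>x. cmod (complex_of_real (max 0 (- Re (h x))) - b x) \<le> e / 4"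
      "\<And>x. h x = 0 \<Longrightarrow> b x = 0"
    using part[of "\<lambda>z. - Re z"] by auto
  obtain c where c: "c \<in> Lipc" "\<And>x. cmod (complex_of_real (max 0 (Im (h x))) - c x) \<le> e / 4"
      "\<And>x. h x = 0 \<Longrightarrow> c x = 0"
    using part[of Im] by auto
  obtain d where d: "d \<in> Lipc" "\<And>x. cmod (complex_of_real (max 0 (- Im (h x))) - d x) \<le> e / 4"
      "\<And>x. h x = 0 \<Longrightarrow> d x = 0"
    using part[of "\<lambda>z. - Im z"] by auto
  define v where "v x = (a x + (-1) * b x) + (\<i> * c x + (- \<i>) * d x)" for x
  have "v \<in> Lipc"
    unfolding v_def by (intro Lipc_add Lipc_cmult a b c d)
  moreover have "cmod (h x - v x) \<le> e" for x
  proof -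
    have "h x - v x = (complex_of_real (max 0 (Re (h x))) - a x)
        - (complex_of_real (max 0 (- Re (h x))) - b x)
        + \<i> * (complex_of_real (max 0 (Im (h x))) - c x)
        - \<i> * (complex_of_real (max 0 (- Im (h x))) - d x)" (is "_ = ?A - ?B + \<i> * ?C - \<i> * ?D")
      by (auto simp: complex_eq_iff v_def max_def)
    also have "cmod \<dots> \<le> cmod ?A + cmod ?B + cmod (\<i> * ?C) + cmod (\<i> * ?D)"
      by (smt (verit) norm_triangle_ineq norm_triangle_ineq4)
    finally show ?thesis using a(2)[of x] b(2)[of x] c(2)[of x] d(2)[of x]
      by (simp add: norm_mult)
  qed
  ultimately show ?thesis using a(3) b(3) c(3) d(3) by (intro bexI[of _ v]) (auto simp: v_def)
qed

text \<open>
  Multiplying by a bump \<open>\<phi>\<close> that is \<open>1\<close> near a centre, and by \<open>1 - \<phi>\<close>, splits off a piece with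
  small support and leaves a function whose support needs one ball less.  Repeating this over a
  finite cover of the support replaces a partition of unity and avoids dividing.
\<close>

lemma small_support_induct:
  fixes A :: "('a::metric_space \<Rightarrow> complex) set"
  assumes fA: "f \<in> A" and K: "compact K" "{x. f x \<noteq> 0} \<subseteq> K"
    and A_mult: "\<And>f \<phi> L. f \<in> A \<Longrightarrow> L-lipschitz_on UNIV \<phi> \<Longrightarrow> (\<lambda>x. complex_of_real (\<phi> x) * f x) \<in> A"
    and nbhd: "\<And>x. open (U x)" "\<And>x. x \<in> U x"
    and lc: "locally_compact_space (euclidean :: 'a topology)"
    and P0: "P (\<lambda>x. 0)"
    and P_add: "\<And>f g. f \<in> A \<Longrightarrow> g \<in> A \<Longrightarrow> P f \<Longrightarrow> P g \<Longrightarrow> P (\<lambda>x. f x + g x)"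
    and P_small: "\<And>f x C. f \<in> A \<Longrightarrow> compact C \<Longrightarrow> {y. f y \<noteq> 0} \<subseteq> C \<Longrightarrow> C \<subseteq> U x \<Longrightarrow> P f"
  shows "P f"
proof -
  have "\<exists>\<rho>>0. compact (cball x (2 * \<rho>)) \<and> cball x (2 * \<rho>) \<subseteq> U x" for x
  proof -
    obtain V C where V: "open V" "compact C" "x \<in> V" "V \<subseteq> C"
      using lc unfolding locally_compact_space_def by simp blast
    have "open (V \<inter> U x)" "x \<in> V \<inter> U x" using V nbhd by auto
    then obtain \<delta> where \<delta>: "\<delta> > 0" "cball x \<delta> \<subseteq> V \<inter> U x"
      using open_contains_cball by meson
    have "compact (C \<inter> cball x \<delta>)" using V by (intro compact_Int_closed) auto
    moreover have "C \<inter> cball x \<delta> = cball x \<delta>" using \<delta> V(4) by auto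
    ultimately show ?thesis using \<delta> by (intro exI[of _ "\<delta> / 2"]) auto
  qed
  then obtain \<rho> where \<rho>: "\<And>x. \<rho> x > 0" "\<And>x. compact (cball x (2 * \<rho> x))"
      "\<And>x. cball x (2 * \<rho> x) \<subseteq> U x"
    by metis
  define \<phi> where "\<phi> x y = max 0 (min 1 (2 - dist x y / \<rho> x))" for x y
  have lip: "(1 / \<rho> x)-lipschitz_on UNIV (\<phi> x)" for x
  proof (rule lipschitz_onI)
    fix y z
    have "dist (\<phi> x y) (\<phi> x z) \<le> \<bar>dist x y / \<rho> x - dist x z / \<rho> x\<bar>"
      by (auto simp: \<phi>_def dist_real_def max_def min_def)
    also have "\<dots> = \<bar>dist x y - dist x z\<bar> / \<rho> x"
      using \<rho>(1)[of x] by (simp flip: diff_divide_distrib)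
    also have "\<dots> \<le> dist y z / \<rho> x"
      using \<rho>(1)[of x] abs_dist_diff_le[of y x z] by (intro divide_right_mono) (auto simp: dist_commute)
    finally show "dist (\<phi> x y) (\<phi> x z) \<le> 1 / \<rho> x * dist y z" by simp
  qed (use \<rho>(1) less_imp_le in auto)
  have lip': "(1 / \<rho> x)-lipschitz_on UNIV (\<lambda>y. 1 - \<phi> x y)" for x
    using lip[of x] unfolding lipschitz_on_def dist_real_def by (simp add: abs_minus_commute)
  have one: "\<phi> x y = 1" if "y \<in> ball x (\<rho> x)" for x y
    using that \<rho>(1)[of x] by (auto simp: \<phi>_def field_simps)
  have zero: "\<phi> x y = 0" if "y \<notin> cball x (2 * \<rho> x)" for x y
    using that \<rho>(1)[of x] by (auto simp: \<phi>_def field_simps)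
  have cover: "P f" if "finite T" "f \<in> A" "{y. f y \<noteq> 0} \<subseteq> (\<Union>x\<in>T. ball x (\<rho> x))" for T f
    using that
  proof (induction T arbitrary: f rule: finite_induct)
    case empty
    then have "f = (\<lambda>x. 0)" by auto
    then show ?case using P0 by simp
  next
    case (insert x T)
    define f1 where "f1 y = complex_of_real (\<phi> x y) * f y" for y
    define f2 where "f2 y = complex_of_real (1 - \<phi> x y) * f y" for y
    have f1: "f1 \<in> A" unfolding f1_def by (rule A_mult[OF insert.prems(1) lip])
    have f2: "f2 \<in> A" unfolding f2_def by (rule A_mult[OF insert.prems(1) lip'])
    have "{y. f1 y \<noteq> 0} \<subseteq> cball x (2 * \<rho> x)" 
      by (rule subsetI, rule ccontr) (simp add: f1_def zero)
    then have "P f1" using P_small[OF f1 \<rho>(2)] \<rho>(3) by blast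
    moreover have "P f2"
    proof (rule insert.IH[OF f2])
      show "{y. f2 y \<noteq> 0} \<subseteq> (\<Union>x\<in>T. ball x (\<rho> x))"
      proof (rule subsetI)
        fix y assume "y \<in> {y. f2 y \<noteq> 0}"
        then have "f y \<noteq> 0" "\<phi> x y \<noteq> 1" by (auto simp: f2_def)
        then show "y \<in> (\<Union>x\<in>T. ball x (\<rho> x))" using insert.prems(2) one[of y x] by blast
      qed
    qed
    ultimately have "P (\<lambda>y. f1 y + f2 y)" using P_add f1 f2 by blast
    moreover have "(\<lambda>y. f1 y + f2 y) = f" by (auto simp: f1_def f2_def algebra_simps)
    ultimately show ?case by simp
  qed
  have "K \<subseteq> (\<Union>x\<in>K. ball x (\<rho> x))" using \<rho>(1) by auto
  then obtain T where T: "finite T" "K \<subseteq> (\<Union>x\<in>T. ball x (\<rho> x))"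
    using compactE_image[OF K(1), of K "\<lambda>x. ball x (\<rho> x)"] by (metis open_ball)
  show ?thesis by (rule cover[OF T(1) fA]) (rule order_trans[OF K(2) T(2)])
qed

section \<open>Algebra of groupoids\<close>

locale algebraic_groupoid =
  fixes G :: "'g groupoid_data"
  assumes is_groupoid: "is_groupoid G"
begin

abbreviation rng where "rng \<equiv> range_map G"
abbreviation src where "src \<equiv> source_map G"
abbreviation inv_G where "inv_G \<equiv> ginv G"
abbreviation mul (infixl "\<cdot>" 70) where "a \<cdot> b \<equiv> gmul G a b"
abbreviation comp where "comp \<equiv> composable G"

lemma inv_inv [simp]: "inv_G (inv_G a) = a"
  and comp_inv_right: "(a, inv_G a) \<in> comp"
  and inv_mul_cancel: "(a, b) \<in> comp \<Longrightarrow> inv_G a \<cdot> (a \<cdot> b) = b"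
  and mul_inv_cancel: "(a, b) \<in> comp \<Longrightarrow> (a \<cdot> b) \<cdot> inv_G b = a"
  and comp_mul_left: "(a, b) \<in> comp \<Longrightarrow> (b, c) \<in> comp \<Longrightarrow> (a \<cdot> b, c) \<in> comp"
  and comp_mul_right: "(a, b) \<in> comp \<Longrightarrow> (b, c) \<in> comp \<Longrightarrow> (a, b \<cdot> c) \<in> comp"
  and mul_assoc: "(a, b) \<in> comp \<Longrightarrow> (b, c) \<in> comp \<Longrightarrow> (a \<cdot> b) \<cdot> c = a \<cdot> (b \<cdot> c)"
  using is_groupoid unfolding is_groupoid_def by blast+

lemma comp_inv_left: "(inv_G a, a) \<in> comp"
  using comp_inv_right[of "inv_G a"] by simp

lemma rng_inv [simp]: "rng (inv_G a) = src a"
  and src_inv [simp]: "src (inv_G a) = rng a"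
  by (simp_all add: range_map_def source_map_def)

lemma comp_iff: "(a, b) \<in> comp \<longleftrightarrow> src a = rng b"
proof
  assume ab: "(a, b) \<in> comp"
  have "src a \<cdot> b = b"
    using mul_assoc[OF comp_inv_left ab] inv_mul_cancel[OF ab] by (simp add: source_map_def)
  moreover have "(src a, b) \<in> comp"
    using comp_mul_left[OF comp_inv_left ab] by (simp add: source_map_def)
  ultimately show "src a = rng b"
    using mul_inv_cancel[of "src a" b] by (simp add: range_map_def)
next
  assume eq: "src a = rng b"
  have asrc: "(a, src a) \<in> comp"
    using comp_mul_right[OF comp_inv_right comp_inv_left] by (simp add: source_map_def)
  have "(rng b, b) \<in> comp"
    using comp_mul_left[OF comp_inv_right comp_inv_left] by (simp add: range_map_def)
  then have "(a \<cdot> src a, b) \<in> comp"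
    using comp_mul_left[OF asrc] eq by simp
  moreover have "a \<cdot> src a = a"
    using mul_assoc[OF comp_inv_right comp_inv_left, of a] mul_inv_cancel[OF comp_inv_right, of a]
    by (simp add: source_map_def)
  ultimately show "(a, b) \<in> comp" by simp
qed

lemma rng_mul: "src a = rng b \<Longrightarrow> rng (a \<cdot> b) = rng a"
  using comp_mul_right[OF comp_inv_left, of a b] comp_iff by (metis src_inv)

lemma src_mul: "src a = rng b \<Longrightarrow> src (a \<cdot> b) = src b"
  using comp_mul_left[OF _ comp_inv_right, of a b] comp_iff by (metis rng_inv)

lemma rng_rng [simp]: "rng (rng a) = rng a"
  using rng_mul[of a "inv_G a"] by (simp add: range_map_def[of G a])

lemma src_rng [simp]: "src (rng a) = rng a"
  using src_mul[of a "inv_G a"] by (simp add: range_map_def[of G a])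

lemma rng_mul_self: "rng a \<cdot> a = a"
  using mul_inv_cancel[OF comp_inv_right, of a] by (simp add: range_map_def)

lemma inv_rng [simp]: "inv_G (rng a) = rng a"
proof -
  have "rng a \<cdot> inv_G (rng a) = rng a"
    using rng_rng[of a] unfolding range_map_def[of G "rng a"] .
  then have "inv_G (rng a) \<cdot> rng a = inv_G (rng a)"
    using inv_mul_cancel[OF comp_inv_right, of "rng a"] by simp
  moreover have "inv_G (rng a) \<cdot> rng a = rng a"
    using src_rng[of a] unfolding source_map_def .
  ultimately show ?thesis by simp
qed

text \<open>
  The factorizations of \<open>c\<close> are indexed by the elements with the range of \<open>c\<close>, which turns the
  convolution into a sum over a fibre of the range map.
\<close>

lemma factorization_iff: "(a, b) \<in> comp \<and> a \<cdot> b = c \<longleftrightarrow> rng a = rng c \<and> b = inv_G a \<cdot> c"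
proof
  assume "(a, b) \<in> comp \<and> a \<cdot> b = c"
  then show "rng a = rng c \<and> b = inv_G a \<cdot> c"
    using inv_mul_cancel rng_mul comp_iff by metis
next
  assume *: "rng a = rng c \<and> b = inv_G a \<cdot> c"
  then have "(inv_G a, c) \<in> comp" by (simp add: comp_iff)
  moreover from this * have "rng b = src a" by (simp add: rng_mul)
  ultimately show "(a, b) \<in> comp \<and> a \<cdot> b = c"
    using inv_mul_cancel[of "inv_G a" c] * by (simp add: comp_iff)
qed

lemma convolution_range_fibre:
  "convolution G f g c = (\<Sum>\<^sub>\<infinity>a\<in>{a. rng a = rng c}. f a * g (inv_G a \<cdot> c))"
proof -
  have "{(a, b). (a, b) \<in> comp \<and> a \<cdot> b = c} = (\<lambda>a. (a, inv_G a \<cdot> c)) ` {a. rng a = rng c}"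
    by (auto simp: factorization_iff)
  then show ?thesis
    unfolding convolution_def
    by (simp add: infsum_reindex inj_on_def o_def)
qed

lemma convolution_single:
  assumes "rng a = rng c" "\<And>b. rng b = rng c \<Longrightarrow> f b \<noteq> 0 \<Longrightarrow> b = a"
  shows "convolution G f g c = f a * g (inv_G a \<cdot> c)"
proof -
  have "convolution G f g c = (\<Sum>\<^sub>\<infinity>a\<in>{a}. f a * g (inv_G a \<cdot> c))"
    unfolding convolution_range_fibre
    by (rule infsum_cong_neutral) (use assms in auto)
  then show ?thesis by simp
qed

lemma convolution_eq_0:
  assumes "\<And>a. rng a = rng c \<Longrightarrow> f a = 0 \<or> g (inv_G a \<cdot> c) = 0"
  shows "convolution G f g c = 0"
  unfolding convolution_range_fibre using assms by (intro infsum_0) auto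

end

section \<open>Topology of etale groupoids\<close>

locale metric_etale_groupoid = algebraic_groupoid G
  for G :: "'g::metric_space groupoid_data" +
  assumes etale: "etale_groupoid G"
    and locally_compact: "locally_compact_space (euclidean :: 'g topology)"
begin

lemma continuous_inv: "continuous_on S inv_G"
  and continuous_mul: "continuous_on comp (\<lambda>(a, b). a \<cdot> b)"
  using etale continuous_on_subset[of UNIV inv_G S]
  unfolding etale_groupoid_def topological_groupoid_def by auto

lemma isCont_inv: "isCont inv_G x"
  using continuous_inv continuous_on_eq_continuous_at by blast

lemma range_slice: "\<exists>U g. open U \<and> x \<in> U \<and> openin (top_of_set (unit_space G)) (rng ` U)
    \<and> homeomorphism U (rng ` U) rng g"
  and source_slice: "\<exists>U g. open U \<and> x \<in> U \<and> openin (top_of_set (unit_space G)) (src ` U)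
    \<and> homeomorphism U (src ` U) src g"
  using etale unfolding etale_groupoid_def local_homeomorphism_into_def by blast+

lemma isCont_rng: "isCont rng x"
proof -
  obtain U g where "open U" "x \<in> U" "homeomorphism U (rng ` U) rng g"
    using range_slice by blast
  then show ?thesis
    using continuous_on_eq_continuous_at homeomorphism_cont1 by blast
qed

lemma isCont_src: "isCont src x"
proof -
  obtain U g where "open U" "x \<in> U" "homeomorphism U (src ` U) src g"
    using source_slice by blast
  then show ?thesis
    using continuous_on_eq_continuous_at homeomorphism_cont1 by blast
qed

lemma open_vimage_rng: "open V \<Longrightarrow> open (rng -` V)"
  using isCont_rng by (simp add: continuous_at_imp_continuous_on open_vimage)

text \<open>
  Let \<open>U\<close> be a neighbourhood of a unit on which the range map is injective.  A point \<open>y\<close> of \<open>U\<close>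
  whose range also lies in \<open>U\<close> has the same range as the unit \<open>rng y\<close>, and so equals it.
\<close>

lemma open_unit_space: "open (unit_space G)"
proof (rule Topological_Spaces.openI)
  fix x assume "x \<in> unit_space G"
  then have x: "rng x = x" by (auto simp: unit_space_def)
  obtain U g where U: "open U" "x \<in> U" "homeomorphism U (rng ` U) rng g"
    using range_slice by blast
  have "rng y = y" if "y \<in> U" "rng y \<in> U" for y
    using that homeomorphism_apply1[OF U(3)] by (metis rng_rng)
  then have "U \<inter> rng -` U \<subseteq> unit_space G" unfolding unit_space_def by (metis IntE rangeI subsetI vimageE)
  moreover have "open (U \<inter> rng -` U)" "x \<in> U \<inter> rng -` U"
    using U x open_vimage_rng by auto
  ultimately show "\<exists>T. open T \<and> x \<in> T \<and> T \<subseteq> unit_space G" by blast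
qed

lemma open_rng_image:
  assumes "open V" shows "open (rng ` V)"
proof (rule Topological_Spaces.openI)
  fix u assume "u \<in> rng ` V"
  then obtain x where x: "x \<in> V" "u = rng x" by blast
  obtain U g where U: "open U" "x \<in> U" "openin (top_of_set (unit_space G)) (rng ` U)"
      "homeomorphism U (rng ` U) rng g"
    using range_slice by blast
  have "openin (top_of_set U) (U \<inter> V)" using assms by (simp add: openin_open_Int)
  then have "openin (top_of_set (rng ` U)) (rng ` (U \<inter> V))"
    by (rule homeomorphism_imp_open_map[OF U(4)])
  then have "openin (top_of_set (unit_space G)) (rng ` (U \<inter> V))"
    using U(3) openin_trans by blast
  then have "open (rng ` (U \<inter> V))"
    using open_unit_space openin_open_trans by blast
  then show "\<exists>T. open T \<and> u \<in> T \<and> T \<subseteq> rng ` V" using U(2) x by blast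
qed

definition bisection :: "'g set \<Rightarrow> bool" where
  "bisection U \<longleftrightarrow> open U \<and> inj_on rng U \<and> inj_on src U"

lemma bisection_nbhd: "\<exists>U. bisection U \<and> x \<in> U"
proof -
  obtain U g where U: "open U" "x \<in> U" "homeomorphism U (rng ` U) rng g"
    using range_slice by blast
  obtain V h where V: "open V" "x \<in> V" "homeomorphism V (src ` V) src h"
    using source_slice by blast
  have "inj_on rng U" by (rule inj_on_inverseI[of _ g]) (rule homeomorphism_apply1[OF U(3)])
  moreover have "inj_on src V" by (rule inj_on_inverseI[of _ h]) (rule homeomorphism_apply1[OF V(3)])
  ultimately have "bisection (U \<inter> V)"
    using U(1) V(1) by (auto simp: bisection_def intro: inj_on_subset)
  then show ?thesis using U V by blast
qed

lemma bisection_inv: "bisection U \<Longrightarrow> bisection (inv_G -` U)"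
  unfolding bisection_def inj_on_def using continuous_inv[of UNIV]
  by (metis inv_inv open_vimage rng_inv src_inv vimage_eq)

text \<open>
  The local section of the range map over a bisection: \<open>rng\<close> is a continuous open injection on \<open>U\<close>.
\<close>

lemma bisection_section:
  assumes "bisection U"
  obtains \<tau> where "continuous_on (rng ` U) \<tau>" "\<And>a. a \<in> U \<Longrightarrow> \<tau> (rng a) = a" "open (rng ` U)"
proof -
  have U: "open U" "inj_on rng U" using assms by (auto simp: bisection_def)
  have "continuous_on (rng ` U) (the_inv_into U rng)"
  proof (rule continuous_on_inverse_open_map)
    show "continuous_on U rng" using isCont_rng by (simp add: continuous_at_imp_continuous_on)
    show "openin (top_of_set (rng ` U)) (rng ` W)" if "openin (top_of_set U) W" for W
      using that U(1) open_rng_image by (auto simp: openin_open_eq intro: open_subset)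
  qed (use U in \<open>auto simp: the_inv_into_f_f\<close>)
  then show ?thesis using that U by (simp add: the_inv_into_f_f open_rng_image)
qed

text \<open>
  A bisection meets each fibre of the range map in at most one point, and finitely many bisections
  cover a compact set.
\<close>

lemma finite_range_fibre:
  assumes "compact K" shows "finite {a \<in> K. rng a = u}"
proof -
  obtain U where U: "\<And>x. bisection (U x)" "\<And>x. x \<in> U x" using bisection_nbhd by metis
  have "open (U x)" for x using U(1) by (auto simp: bisection_def)
  moreover have "K \<subseteq> (\<Union>x\<in>K. U x)" using U(2) by blast
  ultimately obtain T where T: "finite T" "K \<subseteq> (\<Union>x\<in>T. U x)"
    using compactE_image[OF assms, of K U] by metis
  have "finite {a \<in> U x. rng a = u}" for x
  proof (cases "\<exists>b\<in>U x. rng b = u")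
    case True
    then obtain b where "b \<in> U x" "rng b = u" by blast
    then have "{a \<in> U x. rng a = u} \<subseteq> {b}"
      using U(1)[of x] by (auto simp: bisection_def inj_on_def)
    then show ?thesis by (rule finite_subset) simp
  next
    case False
    then have "{a \<in> U x. rng a = u} = {}" by blast
    then show ?thesis by (simp only: finite.emptyI)
  qed
  then have "finite (\<Union>x\<in>T. {a \<in> U x. rng a = u})" using T(1) by blast
  then show ?thesis by (rule rev_finite_subset) (use T(2) in blast)
qed

section \<open>Convolution and involution\<close>

lemma convolution_add_left:
  assumes "f \<in> Cc" "f' \<in> Cc"
  shows "convolution G (\<lambda>x. f x + f' x) g c = convolution G f g c + convolution G f' g c"
proof -
  have summable: "(\<lambda>a. h a * g (inv_G a \<cdot> c)) summable_on {a. rng a = rng c}" if h: "h \<in> Cc" for h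
  proof (rule finite_nonzero_values_imp_summable_on)
    obtain K where K: "compact K" "{x. h x \<noteq> 0} \<subseteq> K" using h by (auto simp: Cc_iff)
    show "finite {a \<in> {a. rng a = rng c}. h a * g (inv_G a \<cdot> c) \<noteq> 0}"
      by (rule finite_subset[OF _ finite_range_fibre[OF K(1), of "rng c"]]) (use K(2) in auto)
  qed
  show ?thesis
    unfolding convolution_range_fibre distrib_right
    by (rule infsum_add) (use summable assms in auto)
qed

text \<open>
  The set of composable pairs is closed, since it is the equalizer of the source of the first and
  the range of the second factor.
\<close>

lemma convolution_support:
  assumes "\<exists>K. compact K \<and> {x. f x \<noteq> 0} \<subseteq> K" "\<exists>K. compact K \<and> {x. g x \<noteq> 0} \<subseteq> K"
  shows "\<exists>K. compact K \<and> {x. convolution G f g x \<noteq> 0} \<subseteq> K"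
proof -
  obtain K L where K: "compact K" "{x. f x \<noteq> 0} \<subseteq> K" and L: "compact L" "{x. g x \<noteq> 0} \<subseteq> L"
    using assms by blast
  have "comp = {p. src (fst p) = rng (snd p)}" using comp_iff by auto
  moreover have "closed {p. src (fst p) = rng (snd p)}"
  proof (rule closed_Collect_eq)
    have "continuous_on UNIV src" "continuous_on UNIV rng"
      using isCont_src isCont_rng by (simp_all add: continuous_at_imp_continuous_on)
    then show "continuous_on UNIV (\<lambda>p::'g \<times> 'g. src (fst p))"
        "continuous_on UNIV (\<lambda>p::'g \<times> 'g. rng (snd p))"
      by (auto intro: continuous_on_compose2[OF _ continuous_on_fst[OF continuous_on_id]]
          continuous_on_compose2[OF _ continuous_on_snd[OF continuous_on_id]])
  qed
  ultimately have "compact (K \<times> L \<inter> comp)"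
    using K(1) L(1) by (intro compact_Int_closed compact_Times) auto
  then have "compact ((\<lambda>(a, b). a \<cdot> b) ` (K \<times> L \<inter> comp))"
    by (intro compact_continuous_image continuous_on_subset[OF continuous_mul]) auto
  moreover have "{x. convolution G f g x \<noteq> 0} \<subseteq> (\<lambda>(a, b). a \<cdot> b) ` (K \<times> L \<inter> comp)"
  proof
    fix c assume "c \<in> {x. convolution G f g x \<noteq> 0}"
    then obtain a where a: "rng a = rng c" "f a \<noteq> 0" "g (inv_G a \<cdot> c) \<noteq> 0"
      using convolution_eq_0[of c f g] by auto
    then have "(a, inv_G a \<cdot> c) \<in> K \<times> L \<inter> comp" "a \<cdot> (inv_G a \<cdot> c) = c"
      using K(2) L(2) factorization_iff[of a "inv_G a \<cdot> c" c] by auto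
    then show "c \<in> (\<lambda>(a, b). a \<cdot> b) ` (K \<times> L \<inter> comp)" by force
  qed
  ultimately show ?thesis by blast
qed

text \<open>
  If \<open>f\<close> lives on a bisection \<open>U\<close>, the sum at \<open>y\<close> has at most one nonzero term: its first factor is
  the point \<open>\<alpha> y\<close> of \<open>U\<close> with the range of \<open>y\<close>, its second factor is \<open>\<beta> y\<close>, which has the source of
  \<open>y\<close>.  The constant \<open>e\<close> is \<open>1\<close> near points whose range lies in \<open>rng ` U\<close>; near the others it is \<open>0\<close>,
  since \<open>rng ` K\<close> is closed and the convolution vanishes at every point with range outside it.
\<close>

lemma convolution_local_form:
  assumes U: "bisection U" and K: "compact K" "K \<subseteq> U" "{x. f x \<noteq> 0} \<subseteq> K"
  obtains V \<alpha> \<beta> e where "open V" "c \<in> V" "\<And>y. y \<in> V \<Longrightarrow> isCont \<alpha> y" "\<And>y. y \<in> V \<Longrightarrow> isCont \<beta> y"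
    "\<And>y. y \<in> V \<Longrightarrow> rng (\<alpha> y) = rng y" "\<And>y. y \<in> V \<Longrightarrow> src (\<beta> y) = src y"
    "\<And>y. y \<in> V \<Longrightarrow> convolution G f g y = e * (f (\<alpha> y) * g (\<beta> y))"
proof (cases "rng c \<in> rng ` U")
  case True
  obtain \<tau> where \<tau>: "continuous_on (rng ` U) \<tau>" "\<And>a. a \<in> U \<Longrightarrow> \<tau> (rng a) = a" "open (rng ` U)"
    using bisection_section[OF U] by blast
  define V where "V = rng -` (rng ` U)"
  define \<alpha> where "\<alpha> y = \<tau> (rng y)" for y
  define \<beta> where "\<beta> y = inv_G (\<alpha> y) \<cdot> y" for y
  have V: "open V" "c \<in> V" using open_vimage_rng[OF \<tau>(3)] True by (auto simp: V_def)
  have \<alpha>U: "\<alpha> y \<in> U" and r\<alpha>: "rng (\<alpha> y) = rng y" if "y \<in> V" for y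
    using that \<tau>(2) by (auto simp: V_def \<alpha>_def)
  have cont_\<alpha>: "continuous_on V \<alpha>"
    unfolding \<alpha>_def using isCont_rng
    by (intro continuous_on_compose2[OF \<tau>(1)]) (auto simp: V_def intro: continuous_at_imp_continuous_on)
  have "continuous_on V (\<lambda>y. (\<lambda>(a, b). a \<cdot> b) (inv_G (\<alpha> y), y))"
  proof (rule continuous_on_compose2[OF continuous_mul])
    show "continuous_on V (\<lambda>y. (inv_G (\<alpha> y), y))"
      using continuous_on_compose2[OF continuous_inv cont_\<alpha>, of UNIV]
      by (intro continuous_intros) auto
    show "(\<lambda>y. (inv_G (\<alpha> y), y)) ` V \<subseteq> comp" using r\<alpha> by (auto simp: comp_iff)
  qed
  then have cont_\<beta>: "continuous_on V \<beta>" by (simp add: \<beta>_def)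
  show ?thesis
  proof (rule that[of V \<alpha> \<beta> 1])
    show "isCont \<alpha> y" "isCont \<beta> y" if "y \<in> V" for y
      using cont_\<alpha> cont_\<beta> V(1) that continuous_on_eq_continuous_at by blast+
    show "src (\<beta> y) = src y" if "y \<in> V" for y
      using r\<alpha>[OF that] by (simp add: \<beta>_def src_mul)
    show "convolution G f g y = 1 * (f (\<alpha> y) * g (\<beta> y))" if "y \<in> V" for y
    proof -
      have "b = \<alpha> y" if "rng b = rng y" "f b \<noteq> 0" for b
      proof -
        have "b \<in> U" using K that(2) by blast
        then show ?thesis using \<tau>(2)[of b] that(1) by (simp add: \<alpha>_def)
      qed
      then show ?thesis using convolution_single[OF r\<alpha>[OF that], of f g] by (simp add: \<beta>_def)
    qed
  qed (use V r\<alpha> in auto)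
next
  case False
  have "closed (rng ` K)"
    using K(1) isCont_rng
    by (intro compact_imp_closed compact_continuous_image) (auto intro: continuous_at_imp_continuous_on)
  then have "open (rng -` (- rng ` K))" using open_vimage_rng by blast
  moreover have "c \<in> rng -` (- rng ` K)" using False K(2) by auto
  moreover have "convolution G f g y = 0" if "y \<in> rng -` (- rng ` K)" for y
  proof (rule convolution_eq_0)
    fix a assume "rng a = rng y"
    then have "a \<notin> K" using that by (metis ComplD imageI vimageD)
    then show "f a = 0 \<or> g (inv_G a \<cdot> y) = 0" using K(3) by blast
  qed
  ultimately show ?thesis
    by (intro that[of "rng -` (- rng ` K)" "\<lambda>y. y" "\<lambda>y. y" 0]) auto
qed

lemma Cc_convolution_bisection:
  assumes f: "f \<in> Cc" and g: "g \<in> Cc"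
    and U: "bisection U" and K: "compact K" "K \<subseteq> U" "{x. f x \<noteq> 0} \<subseteq> K"
  shows "convolution G f g \<in> Cc"
proof -
  have "isCont (convolution G f g) c" for c
  proof (rule convolution_local_form[OF U K, of c g])
    fix V \<alpha> \<beta> e
    assume V: "open V" "c \<in> V"
      and cont: "\<And>y. y \<in> V \<Longrightarrow> isCont \<alpha> y" "\<And>y. y \<in> V \<Longrightarrow> isCont \<beta> y"
      and "\<And>y. y \<in> V \<Longrightarrow> rng (\<alpha> y) = rng y" "\<And>y. y \<in> V \<Longrightarrow> src (\<beta> y) = src y"
      and eq: "\<And>y. y \<in> V \<Longrightarrow> convolution G f g y = e * (f (\<alpha> y) * g (\<beta> y))"
    have "isCont f (\<alpha> c)" "isCont g (\<beta> c)" using f g by (simp_all add: Cc_iff)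
    then have "isCont (\<lambda>y. f (\<alpha> y)) c" "isCont (\<lambda>y. g (\<beta> y)) c"
      using isCont_o2[OF cont(1)[OF V(2)]] isCont_o2[OF cont(2)[OF V(2)]] by blast+
    then have "isCont (\<lambda>y. e * (f (\<alpha> y) * g (\<beta> y))) c"
      by (intro continuous_intros)
    moreover have "eventually (\<lambda>y. convolution G f g y = e * (f (\<alpha> y) * g (\<beta> y))) (nhds c)"
      using V(1,2) eq by (auto simp: eventually_nhds)
    ultimately show "isCont (convolution G f g) c" by (simp only: isCont_cong)
  qed
  moreover have "\<exists>K. compact K \<and> {x. convolution G f g x \<noteq> 0} \<subseteq> K"
    by (rule convolution_support) (use f g in \<open>simp_all add: Cc_iff\<close>)
  ultimately show ?thesis by (simp add: Cc_iff)
qed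

lemma involution_support:
  assumes "\<exists>K. compact K \<and> {x. f x \<noteq> 0} \<subseteq> K"
  shows "\<exists>K. compact K \<and> {x. involution G f x \<noteq> 0} \<subseteq> K"
proof -
  obtain K where K: "compact K" "{x. f x \<noteq> 0} \<subseteq> K" using assms by blast
  have "{x. involution G f x \<noteq> 0} \<subseteq> inv_G ` K"
  proof (rule subsetI)
    fix x assume "x \<in> {x. involution G f x \<noteq> 0}"
    then have "inv_G x \<in> K" using K(2) by (auto simp: involution_def)
    then have "inv_G (inv_G x) \<in> inv_G ` K" by (rule imageI)
    then show "x \<in> inv_G ` K" by simp
  qed
  moreover have "compact (inv_G ` K)" by (rule compact_continuous_image[OF continuous_inv K(1)])
  ultimately show ?thesis by blast
qed

lemma Cc_involution:
  assumes "f \<in> Cc" shows "involution G f \<in> Cc"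
proof -
  have "isCont (\<lambda>x. cnj (f (inv_G x))) x" for x
    by (intro continuous_cnj isCont_o2[OF isCont_inv]) (use assms in \<open>simp add: Cc_iff\<close>)
  then have "isCont (involution G f) x" for x
    unfolding involution_def[abs_def] .
  moreover have "\<exists>K. compact K \<and> {x. involution G f x \<noteq> 0} \<subseteq> K"
    by (rule involution_support) (use assms in \<open>simp add: Cc_iff\<close>)
  ultimately show ?thesis by (simp add: Cc_iff)
qed

end

locale lipschitz_etale_groupoid = metric_etale_groupoid G
  for G :: "'g::metric_space groupoid_data" +
  assumes bi_lipschitz_rng: "locally_bi_lipschitz (range_map G)"
    and bi_lipschitz_src: "locally_bi_lipschitz (source_map G)"
begin

lemma lipschitz_near_inv: "lipschitz_near inv_G x"
proof (rule lipschitz_near_lift[OF bi_lipschitz_rng isCont_inv])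
  show "lipschitz_near (\<lambda>y. rng (inv_G y)) x"
    by (simp add: locally_bi_lipschitz_near[OF bi_lipschitz_src])
qed

lemma Lipc_involution:
  assumes "f \<in> Lipc" shows "involution G f \<in> Lipc"
proof -
  have "lipschitz_near cnj z" for z
    by (rule lipschitz_nearI[of 1]) (auto simp: lipschitz_on_def dist_norm simp flip: complex_cnj_diff)
  moreover have "lipschitz_near f z" for z using assms by (simp add: Lipc_iff)
  ultimately have "lipschitz_near (\<lambda>y. cnj (f (inv_G y))) x" for x
    by (intro lipschitz_near_compose[of "\<lambda>y. f (inv_G y)" x cnj]
        lipschitz_near_compose[of inv_G x f] lipschitz_near_inv)
  then have "lipschitz_near (involution G f) x" for x
    unfolding involution_def[abs_def] .
  moreover have "\<exists>K. compact K \<and> {x. involution G f x \<noteq> 0} \<subseteq> K"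
    by (rule involution_support) (use assms in \<open>simp add: Lipc_iff\<close>)
  ultimately show ?thesis by (simp add: Lipc_iff)
qed

lemma Lipc_convolution_bisection:
  assumes f: "f \<in> Lipc" and g: "g \<in> Lipc"
    and U: "bisection U" and K: "compact K" "K \<subseteq> U" "{x. f x \<noteq> 0} \<subseteq> K"
  shows "convolution G f g \<in> Lipc"
proof -
  have "lipschitz_near (convolution G f g) c" for c
  proof (rule convolution_local_form[OF U K, of c g])
    fix V \<alpha> \<beta> e
    assume V: "open V" "c \<in> V"
      and cont: "\<And>y. y \<in> V \<Longrightarrow> isCont \<alpha> y" "\<And>y. y \<in> V \<Longrightarrow> isCont \<beta> y"
      and \<alpha>: "\<And>y. y \<in> V \<Longrightarrow> rng (\<alpha> y) = rng y" and \<beta>: "\<And>y. y \<in> V \<Longrightarrow> src (\<beta> y) = src y"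
      and eq: "\<And>y. y \<in> V \<Longrightarrow> convolution G f g y = e * (f (\<alpha> y) * g (\<beta> y))"
    have "lipschitz_near \<alpha> c"
      by (rule lipschitz_near_lift[OF bi_lipschitz_rng cont(1)[OF V(2)]],
          rule lipschitz_near_cong[OF locally_bi_lipschitz_near[OF bi_lipschitz_rng] V(1,2)], rule \<alpha>)
    moreover have "lipschitz_near \<beta> c"
      by (rule lipschitz_near_lift[OF bi_lipschitz_src cont(2)[OF V(2)]],
          rule lipschitz_near_cong[OF locally_bi_lipschitz_near[OF bi_lipschitz_src] V(1,2)], rule \<beta>)
    ultimately have "lipschitz_near (\<lambda>y. f (\<alpha> y)) c" "lipschitz_near (\<lambda>y. g (\<beta> y)) c"
      using f g by (auto simp: Lipc_iff intro: lipschitz_near_compose)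
    then have "lipschitz_near (\<lambda>y. e * (f (\<alpha> y) * g (\<beta> y))) c"
      by (intro lipschitz_near_mult lipschitz_nearI[OF lipschitz_on_constant])
    then show "lipschitz_near (convolution G f g) c"
      by (rule lipschitz_near_cong[OF _ V(1,2) eq])
  qed
  moreover have "\<exists>K. compact K \<and> {x. convolution G f g x \<noteq> 0} \<subseteq> K"
    by (rule convolution_support) (use f g in \<open>simp_all add: Lipc_iff\<close>)
  ultimately show ?thesis by (simp add: Lipc_iff)
qed

text \<open>
  Only the first factor needs to be cut into pieces: \<open>convolution_local_form\<close> allows an arbitrary
  second factor.
\<close>

lemma Lipc_convolution:
  assumes f: "f \<in> Lipc" and g: "g \<in> Lipc"
  shows "convolution G f g \<in> Lipc"
proof -
  obtain K where K: "compact K" "{x. f x \<noteq> 0} \<subseteq> K" using f by (auto simp: Lipc_iff)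
  obtain U where U: "\<And>x. bisection (U x)" "\<And>x. x \<in> U x" using bisection_nbhd by metis
  show ?thesis
  proof (rule small_support_induct[OF f K, where U = U and P = "\<lambda>f. convolution G f g \<in> Lipc"])
    fix f :: "'g \<Rightarrow> complex" and \<phi> :: "'g \<Rightarrow> real" and L assume "f \<in> Lipc" "L-lipschitz_on UNIV \<phi>"
    then show "(\<lambda>x. complex_of_real (\<phi> x) * f x) \<in> Lipc"
      by (intro Lipc_mult_left lipschitz_nearI[of L]) (auto simp: lipschitz_on_def dist_of_real)
  next
    have "convolution G (\<lambda>x. 0) g = (\<lambda>x. 0)" by (rule ext, rule convolution_eq_0) simp
    then show "convolution G (\<lambda>x. 0) g \<in> Lipc" using zero_Lipc by simp
  next
    fix f1 f2 :: "'g \<Rightarrow> complex"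
    assume *: "f1 \<in> Lipc" "f2 \<in> Lipc" "convolution G f1 g \<in> Lipc" "convolution G f2 g \<in> Lipc"
    then have "convolution G (\<lambda>x. f1 x + f2 x) g = (\<lambda>c. convolution G f1 g c + convolution G f2 g c)"
      using Lipc_subset_Cc by (intro ext convolution_add_left) auto
    then show "convolution G (\<lambda>x. f1 x + f2 x) g \<in> Lipc" using Lipc_add[OF *(3,4)] by simp
  next
    show "open (U x)" "x \<in> U x" for x using U[of x] by (simp_all add: bisection_def)
  next
    fix f :: "'g \<Rightarrow> complex" and x C
    assume "f \<in> Lipc" "compact C" "{y. f y \<noteq> 0} \<subseteq> C" "C \<subseteq> U x"
    then show "convolution G f g \<in> Lipc" using Lipc_convolution_bisection g U(1) by blast
  qed (rule locally_compact)
qed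

end

section \<open>The operator norm of functions supported in a bisection\<close>

lemma cinner_diff_left: "cinner (x - y) z = cinner x z - cinner y (z::'h::complex_hilbert_space)"
  using cinner_add_left[of "x - y" y z] by simp

lemma cinner_diff_right: "cinner z (x - y) = cinner z x - cinner z (y::'h::complex_hilbert_space)"
  using cinner_diff_left[of x y z] cinner_commute[of z] by (metis complex_cnj_diff)

locale groupoid_representation = metric_etale_groupoid G
  for G :: "'g::metric_space groupoid_data" +
  fixes \<pi> :: "('g \<Rightarrow> complex) \<Rightarrow> ('h::complex_hilbert_space \<Rightarrow>\<^sub>L 'h)"
  assumes representation: "is_representation G \<pi>"
begin

lemma rep_bounded_ops: "f \<in> Cc \<Longrightarrow> \<pi> f \<in> bounded_ops"
  and rep_add: "f \<in> Cc \<Longrightarrow> g \<in> Cc \<Longrightarrow> \<pi> (\<lambda>x. f x + g x) = \<pi> f + \<pi> g"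
  and rep_cmult: "f \<in> Cc \<Longrightarrow> blinfun_apply (\<pi> (\<lambda>x. c * f x)) v = scaleC c (blinfun_apply (\<pi> f) v)"
  and rep_convolution: "f \<in> Cc \<Longrightarrow> g \<in> Cc \<Longrightarrow> \<pi> (convolution G f g) = \<pi> f o\<^sub>L \<pi> g"
  and rep_involution: "f \<in> Cc \<Longrightarrow> is_adjoint (\<pi> (involution G f)) (\<pi> f)"
  using representation unfolding is_representation_def by blast+

lemma rep_zero: "\<pi> (\<lambda>x. 0) = 0"
proof -
  have "(\<lambda>x::'g. 0) \<in> Cc" by (rule subsetD[OF Lipc_subset_Cc zero_Lipc])
  from rep_add[OF this this] have "\<pi> (\<lambda>x. 0) = \<pi> (\<lambda>x. 0) + \<pi> (\<lambda>x. 0)"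
    by (simp only: add_0)
  then show ?thesis by (simp only: add_cancel_right_right)
qed

lemma rep_diff:
  assumes "f \<in> Cc" "g \<in> Cc" shows "\<pi> (\<lambda>x. f x - g x) = \<pi> f - \<pi> g"
proof -
  have g: "(\<lambda>x. - 1 * g x) \<in> Cc" by (rule Cc_cmult[OF assms(2)])
  have "(\<lambda>x. f x + - 1 * g x) \<in> Cc" by (rule Cc_add[OF assms(1) g])
  then have "\<pi> (\<lambda>x. (f x + - 1 * g x) + g x) = \<pi> (\<lambda>x. f x + - 1 * g x) + \<pi> g"
    using assms(2) by (rule rep_add)
  then show ?thesis by simp
qed

text \<open>
  In a nonzero term of the convolution at \<open>c\<close>, both \<open>inv_G a\<close> and \<open>inv_G a \<cdot> c\<close> lie in the
  bisection \<open>U\<close> and have the same range, so they agree and \<open>c\<close> is the unit \<open>rng a\<close>.  Injectivity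
  of \<open>src\<close> on \<open>U\<close> leaves a single term, whose value is the square of the modulus of
  \<open>h (inv_G a)\<close>.
\<close>

lemma bisection_square_values:
  assumes U: "bisection U" "{x. h x \<noteq> 0} \<subseteq> U" and bound: "\<And>x. cmod (h x) \<le> M"
  shows "\<exists>t\<ge>0. t \<le> M\<^sup>2 \<and> convolution G (involution G h) h c = complex_of_real t \<and> (rng c \<noteq> c \<longrightarrow> t = 0)"
proof (cases "\<exists>a. rng a = rng c \<and> involution G h a \<noteq> 0 \<and> h (inv_G a \<cdot> c) \<noteq> 0")
  case False
  then have "convolution G (involution G h) h c = 0" by (intro convolution_eq_0) blast
  then show ?thesis by (intro exI[of _ 0]) simp
next
  case True
  then obtain a where a: "rng a = rng c" "involution G h a \<noteq> 0" "h (inv_G a \<cdot> c) \<noteq> 0" by blast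
  have inU: "inv_G b \<in> U" if "involution G h b \<noteq> 0" for b
    using that U(2) by (auto simp: involution_def)
  have "rng (inv_G a \<cdot> c) = rng (inv_G a)" using a(1) by (simp add: rng_mul)
  moreover have "inv_G a \<cdot> c \<in> U" "inv_G a \<in> U" using a U(2) inU by auto
  ultimately have eq: "inv_G a \<cdot> c = inv_G a"
    using U(1) by (auto simp: bisection_def inj_on_def)
  have "c = a \<cdot> (inv_G a \<cdot> c)" using factorization_iff[of a "inv_G a \<cdot> c" c] a(1) by simp
  also have "\<dots> = rng a" by (simp add: eq range_map_def)
  finally have unit: "rng c = c" using a(1) by simp
  have "convolution G (involution G h) h c = involution G h a * h (inv_G a \<cdot> c)"
  proof (rule convolution_single[OF a(1)])
    fix b assume b: "rng b = rng c" "involution G h b \<noteq> 0"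
    have "src (inv_G b) = src (inv_G a)" using b a(1) by simp
    then have "inv_G b = inv_G a"
      using inU b(2) a(2) U(1) by (auto simp: bisection_def inj_on_def)
    then show "b = a" by (metis inv_inv)
  qed
  also have "\<dots> = complex_of_real ((cmod (h (inv_G a)))\<^sup>2)"
    unfolding eq involution_def complex_norm_square by (rule mult.commute)
  finally show ?thesis
    using unit bound by (intro exI[of _ "(cmod (h (inv_G a)))\<^sup>2"]) (simp add: power_mono)
qed

text \<open>
  No continuity of \<open>\<pi>\<close> is assumed, so the bound on the norm comes from positivity.  Let \<open>k\<close> be the convolution of \<open>involution G h\<close> and \<open>h\<close>.  Its values lie in
  \<open>[0, M\<^sup>2]\<close> and it lives on the unit space, where convolution is pointwise multiplication.
  Therefore \<open>q = 1 - sqrt (1 - k / M\<^sup>2)\<close>, which has the support of \<open>k\<close>, satisfies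
  \<open>2 q - q \<cdot> q = k / M\<^sup>2\<close>, and
  \<open>0 \<le> (norm (v - \<pi> q v))\<^sup>2 = (norm v)\<^sup>2 - (norm (\<pi> h v))\<^sup>2 / M\<^sup>2\<close>.
\<close>

lemma norm_rep_bisection_le:
  assumes h: "h \<in> Cc" and U: "bisection U" and K: "compact K" "K \<subseteq> U" "{x. h x \<noteq> 0} \<subseteq> K"
    and bound: "\<And>x. cmod (h x) \<le> M" and M: "M > 0"
  shows "norm (\<pi> h) \<le> M"
proof -
  define k where "k = convolution G (involution G h) h"
  have h': "involution G h \<in> Cc" by (rule Cc_involution[OF h])
  have k: "k \<in> Cc"
    unfolding k_def
  proof (rule Cc_convolution_bisection[OF h' h bisection_inv[OF U]])
    show "compact (inv_G ` K)" by (rule compact_continuous_image[OF continuous_inv K(1)])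
    show "inv_G ` K \<subseteq> inv_G -` U" using K(2) by auto
    show "{x. involution G h x \<noteq> 0} \<subseteq> inv_G ` K"
    proof
      fix x assume "x \<in> {x. involution G h x \<noteq> 0}"
      then have "inv_G x \<in> K" using K(3) by (auto simp: involution_def)
      then show "x \<in> inv_G ` K" by (metis imageI inv_inv)
    qed
  qed
  have "{x. h x \<noteq> 0} \<subseteq> U" using K by blast
  from bisection_square_values[OF U this bound] obtain t where
    t: "\<And>c. 0 \<le> t c" "\<And>c. t c \<le> M\<^sup>2" "\<And>c. k c = complex_of_real (t c)"
       "\<And>c. rng c \<noteq> c \<Longrightarrow> t c = 0"
    unfolding k_def by metis
  define q where "q c = complex_of_real (1 - sqrt (1 - t c / M\<^sup>2))" for c
  have M2: "M\<^sup>2 > 0" using M by simp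
  have q_unit: "rng c = c" if "q c \<noteq> 0" for c
    using that t(4)[of c] by (auto simp: q_def)
  have q: "q \<in> Cc"
  proof -
    have t_Re: "t c = Re (k c)" for c using t(3) by simp
    have "isCont (\<lambda>c. complex_of_real (1 - sqrt (1 - Re (k c) / M\<^sup>2))) x" for x
      using k M by (intro continuous_intros) (auto simp: Cc_iff)
    then have "isCont q x" for x unfolding q_def[abs_def] t_Re .
    moreover obtain C where "compact C" "{x. k x \<noteq> 0} \<subseteq> C" using k by (auto simp: Cc_iff)
    moreover have "{x. q x \<noteq> 0} \<subseteq> {x. k x \<noteq> 0}" by (auto simp: q_def t(3))
    ultimately show ?thesis unfolding Cc_iff by blast
  qed
  have inv_unit: "inv_G c = c" if "rng c = c" for c using that inv_rng by metis
  have q_star: "involution G q = q"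
  proof
    fix c
    show "involution G q c = q c"
    proof (cases "rng c = c")
      case True
      then show ?thesis by (simp add: involution_def inv_unit) (simp add: q_def)
    next
      case False
      then have "rng (inv_G c) \<noteq> inv_G c" using inv_unit by (metis inv_inv)
      then have "q (inv_G c) = 0" "q c = 0" using q_unit False by blast+
      then show ?thesis by (simp add: involution_def)
    qed
  qed
  have q_square: "convolution G q q = (\<lambda>c. q c * q c)"
  proof
    fix c
    have "convolution G q q c = q (rng c) * q (inv_G (rng c) \<cdot> c)"
      by (rule convolution_single) (use q_unit in force)+
    also have "\<dots> = q (rng c) * q c" by (simp add: rng_mul_self)
    also have "\<dots> = q c * q c" using q_unit[of c] by (cases "q c = 0") auto
    finally show "convolution G q q c = q c * q c" .
  qed
  have k_eq: "k = (\<lambda>c. complex_of_real (M\<^sup>2) * (2 * q c + (- 1) * convolution G q q c))"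
  proof
    fix c
    have "0 \<le> 1 - t c / M\<^sup>2" using t(2)[of c] M2 by simp
    define y where "y = sqrt (1 - t c / M\<^sup>2)"
    have "y\<^sup>2 = 1 - t c / M\<^sup>2" using \<open>0 \<le> 1 - t c / M\<^sup>2\<close> by (simp add: y_def)
    moreover have "2 * (1 - y) - (1 - y) * (1 - y) = 1 - y\<^sup>2"
      by (simp add: power2_eq_square algebra_simps)
    ultimately have "t c = M\<^sup>2 * (2 * (1 - y) - (1 - y) * (1 - y))"
      using M2 by simp
    then have "complex_of_real (t c) = complex_of_real (M\<^sup>2)
        * (2 * complex_of_real (1 - y) + (- 1) * (complex_of_real (1 - y) * complex_of_real (1 - y)))"
      by simp
    then show "k c = complex_of_real (M\<^sup>2) * (2 * q c + (- 1) * convolution G q q c)"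
      by (simp only: q_square t(3) q_def y_def)
  qed
  define Q where "Q = blinfun_apply (\<pi> q)"
  have qq: "convolution G q q \<in> Cc"
    unfolding q_square using q by (intro Cc_mult_left) (auto simp: Cc_iff)
  have k_apply: "blinfun_apply (\<pi> k) v
      = scaleC (complex_of_real (M\<^sup>2)) (scaleC 2 (Q v) + scaleC (- 1) (Q (Q v)))" for v
  proof -
    have q2: "(\<lambda>c. 2 * q c) \<in> Cc" by (rule Cc_cmult[OF q])
    have qq': "(\<lambda>c. (- 1) * convolution G q q c) \<in> Cc" by (rule Cc_cmult[OF qq])
    have "blinfun_apply (\<pi> (\<lambda>c. 2 * q c + (- 1) * convolution G q q c)) v
        = scaleC 2 (Q v) + scaleC (- 1) (Q (Q v))"
      unfolding rep_add[OF q2 qq'] plus_blinfun.rep_eq rep_cmult[OF q] rep_cmult[OF qq]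
        rep_convolution[OF q q] by (simp add: Q_def)
    then show ?thesis by (subst k_eq) (simp only: rep_cmult[OF Cc_add[OF q2 qq']])
  qed
  have "norm (blinfun_apply (\<pi> h) v) \<le> M * norm v" for v
  proof -
    define w where "w = blinfun_apply (\<pi> h) v"
    have selfadj: "cinner (Q x) y = cinner x (Q y)" for x y
      using rep_involution[OF q] by (simp add: q_star is_adjoint_def Q_def)
    have "cinner w w = cinner (blinfun_apply (\<pi> (involution G h)) w) v"
      using rep_involution[OF h] by (simp add: is_adjoint_def w_def)
    also have "\<dots> = cinner (blinfun_apply (\<pi> k) v) v"
      by (simp add: k_def rep_convolution[OF h' h] w_def)
    also have "\<dots> = complex_of_real (M\<^sup>2) * (2 * cinner (Q v) v - cinner (Q (Q v)) v)"
      by (simp add: k_apply cinner_scaleC_left cinner_add_left)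
    finally have "2 * cinner (Q v) v - cinner (Q (Q v)) v = cinner w w / complex_of_real (M\<^sup>2)"
      using M2 by (simp add: field_simps)
    moreover have "cinner (v - Q v) (v - Q v) = cinner v v - (2 * cinner (Q v) v - cinner (Q (Q v)) v)"
      by (simp add: cinner_diff_left cinner_diff_right selfadj)
    ultimately have "complex_of_real ((norm (v - Q v))\<^sup>2)
        = complex_of_real ((norm v)\<^sup>2 - (norm w)\<^sup>2 / M\<^sup>2)"
      by (simp add: cinner_self)
    then have "(norm (v - Q v))\<^sup>2 = (norm v)\<^sup>2 - (norm w)\<^sup>2 / M\<^sup>2"
      by (simp only: of_real_eq_iff)
    then have "(norm w)\<^sup>2 / M\<^sup>2 \<le> (norm v)\<^sup>2"
      using zero_le_power2[of "norm (v - Q v)"] by linarith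
    then have "(norm w)\<^sup>2 \<le> (M * norm v)\<^sup>2"
      using M2 by (simp add: field_simps power_mult_distrib)
    then have "norm w \<le> M * norm v" by (rule power2_le_imp_le) (use M in simp)
    then show ?thesis by (simp only: w_def)
  qed
  then show ?thesis using M by (intro norm_blinfun_bound) auto
qed

section \<open>Density\<close>

text \<open>
  Uniform approximation inside one bisection is approximation in operator norm.  Without a
  common bisection the uniform norm does not control the operator norm in general, and for this reason the general
  case goes through \<open>small_support_induct\<close> instead of approximating the whole function at once.
\<close>

lemma rep_bisection_in_closure:
  assumes f: "f \<in> Cc" and U: "bisection U" and K: "compact K" "K \<subseteq> U" "{x. f x \<noteq> 0} \<subseteq> K"
  shows "\<pi> f \<in> closure (\<pi> ` Lipc)"
proof -
  have "\<exists>T\<in>\<pi> ` Lipc. dist T (\<pi> f) < e" if "e > 0" for e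
  proof -
    have e2: "e / 2 > 0" using \<open>e > 0\<close> by simp
    obtain v where v: "v \<in> Lipc" "\<And>x. cmod (f x - v x) \<le> e / 2" "\<And>x. f x = 0 \<Longrightarrow> v x = 0"
      using Lipc_approx[OF f e2] by blast
    have v': "v \<in> Cc" using v(1) Lipc_subset_Cc by blast
    have "(\<lambda>x. f x - v x) \<in> Cc" using Cc_add[OF f Cc_cmult[OF v', of "- 1"]] by simp
    moreover have "{x. f x - v x \<noteq> 0} \<subseteq> K" using v(3) K(3) by force
    ultimately have "norm (\<pi> (\<lambda>x. f x - v x)) \<le> e / 2"
      using norm_rep_bisection_le[OF _ U K(1,2)] v(2) e2 by blast
    then have "dist (\<pi> v) (\<pi> f) < e"
      using that by (simp add: rep_diff[OF f v'] dist_norm norm_minus_commute)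
    then show ?thesis using v(1) by blast
  qed
  then show ?thesis by (simp add: closure_approachable)
qed

lemma rep_in_closure:
  assumes f: "f \<in> Cc" shows "\<pi> f \<in> closure (\<pi> ` Lipc)"
proof -
  obtain K where K: "compact K" "{x. f x \<noteq> 0} \<subseteq> K" using f by (auto simp: Cc_iff)
  obtain U where U: "\<And>x. bisection (U x)" "\<And>x. x \<in> U x" using bisection_nbhd by metis
  show ?thesis
  proof (rule small_support_induct[OF f K, where U = U and P = "\<lambda>f. \<pi> f \<in> closure (\<pi> ` Lipc)"])
    fix f :: "'g \<Rightarrow> complex" and \<phi> :: "'g \<Rightarrow> real" and L
    assume "f \<in> Cc" "L-lipschitz_on UNIV \<phi>"
    then show "(\<lambda>x. complex_of_real (\<phi> x) * f x) \<in> Cc"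
      by (intro Cc_mult_left lipschitz_near_isCont lipschitz_nearI[of L])
        (auto simp: lipschitz_on_def dist_of_real)
  next
    show "\<pi> (\<lambda>x. 0) \<in> closure (\<pi> ` Lipc)"
      by (rule subsetD[OF closure_subset imageI[OF zero_Lipc]])
  next
    fix f1 f2 :: "'g \<Rightarrow> complex"
    assume f: "f1 \<in> Cc" "f2 \<in> Cc" and cl: "\<pi> f1 \<in> closure (\<pi> ` Lipc)" "\<pi> f2 \<in> closure (\<pi> ` Lipc)"
    obtain S T where S: "\<And>n. S n \<in> \<pi> ` Lipc" "S \<longlonglongrightarrow> \<pi> f1" and T: "\<And>n. T n \<in> \<pi> ` Lipc" "T \<longlonglongrightarrow> \<pi> f2"
      using cl unfolding closure_sequential by blast
    have "S n + T n \<in> \<pi> ` Lipc" for n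
    proof -
      obtain a b where "a \<in> Lipc" "b \<in> Lipc" "S n = \<pi> a" "T n = \<pi> b" using S(1)[of n] T(1)[of n] by blast
      moreover from this have "\<pi> (\<lambda>x. a x + b x) = \<pi> a + \<pi> b" using rep_add Lipc_subset_Cc by blast
      ultimately show ?thesis using Lipc_add by (metis imageI)
    qed
    moreover have "(\<lambda>n. S n + T n) \<longlonglongrightarrow> \<pi> f1 + \<pi> f2" using S(2) T(2) by (rule tendsto_add)
    ultimately have "\<pi> f1 + \<pi> f2 \<in> closure (\<pi> ` Lipc)"
      unfolding closure_sequential by (intro exI[of _ "\<lambda>n. S n + T n"] conjI allI)
    then show "\<pi> (\<lambda>x. f1 x + f2 x) \<in> closure (\<pi> ` Lipc)" using rep_add f by simp
  next
    show "open (U x)" "x \<in> U x" for x using U[of x] by (simp_all add: bisection_def)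
  next
    fix f :: "'g \<Rightarrow> complex" and x C
    assume "f \<in> Cc" "compact C" "{y. f y \<noteq> 0} \<subseteq> C" "C \<subseteq> U x"
    then show "\<pi> f \<in> closure (\<pi> ` Lipc)" using rep_bisection_in_closure U(1) by blast
  qed (rule locally_compact)
qed

end

section \<open>The dense subalgebra of Lipschitz functions\<close>

theorem proposition5p1:
  fixes G :: "'g::{metric_space, second_countable_topology} groupoid_data"
    and \<pi> :: "('g \<Rightarrow> complex) \<Rightarrow> ('h::complex_hilbert_space \<Rightarrow>\<^sub>L 'h)"
  assumes "locally_compact_space (euclidean :: 'g topology)"
    and "etale_groupoid G"
    and "faithful_representation G \<pi>"
    and "locally_bi_lipschitz (range_map G)"
    and "locally_bi_lipschitz (source_map G)"
  shows "(Lipc :: ('g \<Rightarrow> complex) set) \<subseteq> Cc \<and>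
    star_subalgebra (\<pi> ` Lipc) (C_star_algebra \<pi>) \<and>
    C_star_algebra \<pi> \<subseteq> closure (\<pi> ` Lipc)"
proof -
  have "is_groupoid G"
    using assms(2) by (simp add: etale_groupoid_def topological_groupoid_def)
  then interpret lipschitz_etale_groupoid G
    using assms by unfold_locales auto
  interpret groupoid_representation G \<pi>
    using assms(3) by unfold_locales (simp add: faithful_representation_def)
  have Cc: "f \<in> Cc" if "f \<in> Lipc" for f :: "'g \<Rightarrow> complex"
    using that Lipc_subset_Cc by blast
  have "star_subalgebra (\<pi> ` Lipc) (C_star_algebra \<pi>)"
    unfolding star_subalgebra_def
  proof (intro conjI ballI allI)
    show "\<pi> ` Lipc \<subseteq> C_star_algebra \<pi>"
      unfolding C_star_algebra_def using Lipc_subset_Cc closure_subset by blast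
    show "\<pi> ` Lipc \<subseteq> bounded_ops" using Cc rep_bounded_ops by blast
    show "0 \<in> \<pi> ` Lipc" using rep_zero zero_Lipc by (metis imageI)
  next
    fix S T assume "S \<in> \<pi> ` Lipc" "T \<in> \<pi> ` Lipc"
    then obtain f g where fg: "f \<in> Lipc" "g \<in> Lipc" "S = \<pi> f" "T = \<pi> g" by blast
    have "S + T = \<pi> (\<lambda>x. f x + g x)" "S o\<^sub>L T = \<pi> (convolution G f g)"
      using fg Cc by (simp_all add: rep_add rep_convolution)
    then show "S + T \<in> \<pi> ` Lipc" "S o\<^sub>L T \<in> \<pi> ` Lipc"
      using Lipc_add[OF fg(1,2)] Lipc_convolution[OF fg(1,2)] by simp_all
  next
    fix c T assume "T \<in> \<pi> ` Lipc"
    then obtain f where f: "f \<in> Lipc" "T = \<pi> f" by blast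
    show "\<exists>S\<in>\<pi> ` Lipc. \<forall>v. blinfun_apply S v = scaleC c (blinfun_apply T v)"
      using f Lipc_cmult[OF f(1), of c] rep_cmult[OF Cc[OF f(1)], of c] by blast
  next
    fix T assume "T \<in> \<pi> ` Lipc"
    then obtain f where f: "f \<in> Lipc" "T = \<pi> f" by blast
    show "\<exists>S\<in>\<pi> ` Lipc. is_adjoint S T"
      using f Lipc_involution[OF f(1)] rep_involution[OF Cc[OF f(1)]] by blast
  qed
  moreover have "C_star_algebra \<pi> \<subseteq> closure (\<pi> ` Lipc)"
    unfolding C_star_algebra_def
    by (rule closure_minimal) (use rep_in_closure in auto)
  ultimately show ?thesis using Lipc_subset_Cc by blast
qed

end
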